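(* In the setting described in the context, there exists a constant $C>0$, depending on $r$ but independent of $K\ge r$ and of $c$, such that for every $K\ge r$ and every $c>0$, $$W_{\mathrm{MC}}(c)-W_K(c)\le \frac{C}{\sqrt K}.$$ Consequently $V_{\mathrm{MC}}-V_K\le \dfrac{C}{\sqrt K}$ for every $K\ge r$.
   Context: Let $1\le r\le K$ be integers and $n\ge1$. Let $\bar{\boldsymbol\zeta}\in\mathbb R^n$, $L_r\in\mathbb R^{n\times r}$, and $L_K:=[L_r,0]\in\mathbb R^{n\times K}$ (the last $K-r$ columns are zero). Let $g:\mathbb R^n\to\mathbb R$ be convex with $g(\bar{\boldsymbol\zeta})<0$. For $m\in\{r,K\}$ and $\boldsymbol v\in\mathbb S^{m-1}$ define $\rho_m(\boldsymbol v):=\sup\{t\ge0: g(\bar{\boldsymbol\zeta}+tL_m\boldsymbol v)\le 0\}\in[0,+\infty]$. Let $F_{\chi_m}$ denote the CDF of the Chi distribution with $m$ degrees of freedom, with $F_{\chi_m}(+\infty)=1$. Let $\boldsymbol\nu_m\sim\mathcal U(\mathbb S^{m-1})$ (uniform on the unit sphere), and let $\varphi:=\mathbb P(g(\boldsymbol\zeta)\le 0)$ for $\boldsymbol\zeta\sim\mathcal N(\bar{\boldsymbol\zeta},L_rL_r^T)$. Define $V_K:=\mathrm{Var}(F_{\chi_K}(\rho_K(\boldsymbol\nu_K)))$ (variance of the $K$-dimensional spherical-radial estimator) and $V_{\mathrm{MC}}:=\varphi(1-\varphi)$ (variance of a single standard Monte Carlo indicator sample). Let $\tau_{r,K}:=\|\boldsymbol\nu_K^{(r)}\|_2^2$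 where $\boldsymbol\nu_K^{(r)}$ is the vector of the first $r$ entries of $\boldsymbol\nu_K$ (distributed as $\mathrm{Beta}(r/2,(K-r)/2)$ if $r<K$, equal to $1$ if $r=K$). For $c\ge0$ define $$W_K(c):=\mathbb E_{\tau_{r,K}}\Big[\Big(F_{\chi_K}\big(c/\sqrt{\tau_{r,K}}\big)-F_{\chi_r}(c)\Big)^2\Big],\qquad W_{\mathrm{MC}}(c):=F_{\chi_r}(c)\big(1-F_{\chi_r}(c)\big).$$ *)

theory Defs
  imports "HOL-Probability.Probability"
begin

text \<open>Vectors of R^m are represented as functions nat => real; only the
coordinates 0..m-1 are meaningful. Matrices are functions nat => nat => real.\<close>

definition sqnorm :: "nat \<Rightarrow> (nat \<Rightarrow> real) \<Rightarrow> real" where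
  "sqnorm m x = (\<Sum>i<m. (x i)\<^sup>2)"

definition mat_vec :: "nat \<Rightarrow> (nat \<Rightarrow> nat \<Rightarrow> real) \<Rightarrow> (nat \<Rightarrow> real) \<Rightarrow> (nat \<Rightarrow> real)" where
  "mat_vec m A v = (\<lambda>i. \<Sum>j<m. A i j * v j)"

definition leb :: "nat \<Rightarrow> (nat \<Rightarrow> real) measure" where
  "leb m = (\<Pi>\<^sub>M i\<in>{..<m}. lborel)"

definition std_gauss :: "nat \<Rightarrow> (nat \<Rightarrow> real) measure" where
  "std_gauss m = (\<Pi>\<^sub>M i\<in>{..<m}. density lborel std_normal_density)"

text \<open>Uniform distribution on the unit sphere S^{m-1} (normalised surface measure),
  defined as the cone measure: the image of the uniform distribution on the unit ball
  under radial projection x |-> x / |x|.\<close>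
definition unit_ball_set :: "nat \<Rightarrow> (nat \<Rightarrow> real) set" where
  "unit_ball_set m = {x \<in> space (leb m). sqnorm m x \<le> 1}"

definition unif_sphere :: "nat \<Rightarrow> (nat \<Rightarrow> real) measure" where
  "unif_sphere m = distr (uniform_measure (leb m) (unit_ball_set m)) (leb m)
      (\<lambda>x. \<lambda>i\<in>{..<m}. x i / sqrt (sqnorm m x))"

definition chi_density :: "nat \<Rightarrow> real \<Rightarrow> real" where
  "chi_density m x = (if x < 0 then 0 else
     x ^ (m - 1) * exp (- (x\<^sup>2) / 2) / (2 powr (real m / 2 - 1) * Gamma (real m / 2)))"

definition chi_cdf :: "nat \<Rightarrow> real \<Rightarrow> real" where
  "chi_cdf m t = (if t < 0 then 0 else integral {0..t} (chi_density m))"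

definition chi_cdf_ext :: "nat \<Rightarrow> ereal \<Rightarrow> real" where
  "chi_cdf_ext m t = (if t = \<infinity> then 1 else if t = -\<infinity> then 0 else chi_cdf m (real_of_ereal t))"

definition pad_mat :: "nat \<Rightarrow> (nat \<Rightarrow> nat \<Rightarrow> real) \<Rightarrow> (nat \<Rightarrow> nat \<Rightarrow> real)" where
  "pad_mat r L = (\<lambda>i j. if j < r then L i j else 0)"

definition rho :: "nat \<Rightarrow> (nat \<Rightarrow> real) \<Rightarrow> (nat \<Rightarrow> nat \<Rightarrow> real) \<Rightarrow> ((nat \<Rightarrow> real) \<Rightarrow> real)
                    \<Rightarrow> (nat \<Rightarrow> real) \<Rightarrow> ereal" where
  "rho m zb Lm g v = Sup {ereal t | t. 0 \<le> t \<and> g (\<lambda>i. zb i + t * mat_vec m Lm v i) \<le> 0}"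

definition convex_Rn :: "nat \<Rightarrow> ((nat \<Rightarrow> real) \<Rightarrow> real) \<Rightarrow> bool" where
  "convex_Rn n g = (\<forall>x y \<theta>. (\<forall>i\<ge>n. x i = 0) \<longrightarrow> (\<forall>i\<ge>n. y i = 0) \<longrightarrow> 0 \<le> \<theta> \<longrightarrow> \<theta> \<le> 1 \<longrightarrow>
      g (\<lambda>i. \<theta> * x i + (1 - \<theta>) * y i) \<le> \<theta> * g x + (1 - \<theta>) * g y)"

text \<open>phi = P(g(zeta) <= 0) for zeta ~ N(zb, L_r L_r^T), realised as zeta = zb + L_r Z, Z ~ N(0, I_r).\<close>
definition phi_prob :: "nat \<Rightarrow> (nat \<Rightarrow> real) \<Rightarrow> (nat \<Rightarrow> nat \<Rightarrow> real) \<Rightarrow> ((nat \<Rightarrow> real) \<Rightarrow> real) \<Rightarrow> real" where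
  "phi_prob r zb L g = measure (std_gauss r)
      {z \<in> space (std_gauss r). g (\<lambda>i. zb i + mat_vec r L z i) \<le> 0}"

definition V_MC :: "nat \<Rightarrow> (nat \<Rightarrow> real) \<Rightarrow> (nat \<Rightarrow> nat \<Rightarrow> real) \<Rightarrow> ((nat \<Rightarrow> real) \<Rightarrow> real) \<Rightarrow> real" where
  "V_MC r zb L g = phi_prob r zb L g * (1 - phi_prob r zb L g)"

definition V_K :: "nat \<Rightarrow> nat \<Rightarrow> (nat \<Rightarrow> real) \<Rightarrow> (nat \<Rightarrow> nat \<Rightarrow> real) \<Rightarrow> ((nat \<Rightarrow> real) \<Rightarrow> real) \<Rightarrow> real" where
  "V_K r K zb L g =
     (let X = (\<lambda>v. chi_cdf_ext K (rho K zb (pad_mat r L) g v));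
          mX = integral\<^sup>L (unif_sphere K) X
      in integral\<^sup>L (unif_sphere K) (\<lambda>v. (X v - mX)\<^sup>2))"

definition W_K :: "nat \<Rightarrow> nat \<Rightarrow> real \<Rightarrow> real" where
  "W_K r K c = integral\<^sup>L (unif_sphere K)
      (\<lambda>v. (chi_cdf K (c / sqrt (sqnorm r v)) - chi_cdf r c)\<^sup>2)"

definition W_MC :: "nat \<Rightarrow> real \<Rightarrow> real" where
  "W_MC r c = chi_cdf r c * (1 - chi_cdf r c)"

end

theory Submission
  imports Defs
begin

text \<open>Let \<open>\<phi>\<close> be the Gaussian mass of a star-shaped set \<open>S\<close> in the first \<open>r\<close> coordinates, and let
  \<open>X(v) = P(R v \<in> S)\<close> with \<open>R\<close> chi-distributed with \<open>K\<close> degrees of freedom. In polar coordinates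
  \<open>E X(\<nu>) = \<phi>\<close>, so the gap \<open>\<phi>(1 - \<phi>) - Var X(\<nu>)\<close> equals \<open>E[X(1 - X)]\<close>, which is at most the
  probability that exactly one of \<open>R \<nu>\<close> and \<open>\<surd>K \<nu>\<close> lies in \<open>S\<close>, \<open>R\<close> independent of \<open>\<nu>\<close>.

  For fixed \<open>a \<le> b\<close>, write \<open>\<nu> = Z / |Z|\<close> with \<open>Z = (Y, U)\<close> Gaussian in \<open>R^r \<times> R^(K - r)\<close>. Given \<open>U\<close> and
  the direction of \<open>Y\<close>, the event that \<open>a \<nu>\<close> lies in \<open>S\<close> and \<open>b \<nu>\<close> does not confines
  \<open>ln (|Y| / |Z|)\<close> to an interval of length \<open>ln (b / a)\<close>, and this variable has a density of order
  \<open>1 + 1 / |U|^2\<close>. As \<open>E (1 / |U|^2) = 1 / (K - r - 2)\<close>, the event has probability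
  \<open>O(ln (b / a))\<close>, and the chi moments give \<open>E |ln (R / \<surd>K)| = O(1 / \<surd>K)\<close>.\<close>

section \<open>Polar decomposition of the Gaussian measure\<close>

text \<open>Index sets are kept general because a Gaussian vector is later split into the blocks
  \<open>{r..<K}\<close> and \<open>{..<r}\<close>, and polar coordinates are taken in each block as
  well as in the whole space.\<close>

abbreviation Leb :: "nat set \<Rightarrow> (nat \<Rightarrow> real) measure" where
  "Leb I \<equiv> Pi\<^sub>M I (\<lambda>_. lborel)"

text \<open>Division by zero sends a vector of norm \<open>0\<close> to the zero vector, which makes
  \<open>scale_dir\<close> valid at every point.\<close>

definition dir :: "nat set \<Rightarrow> (nat \<Rightarrow> real) \<Rightarrow> nat \<Rightarrow> real" where
  "dir I x = (\<lambda>i\<in>I. x i / L2_set x I)"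

definition sphere_measure :: "nat set \<Rightarrow> (nat \<Rightarrow> real) measure" where
  "sphere_measure I =
     distr (uniform_measure (Leb I) {x \<in> space (Leb I). L2_set x I \<le> 1}) (Leb I) (dir I)"

definition gauss :: "nat set \<Rightarrow> (nat \<Rightarrow> real) measure" where
  "gauss I = (\<Pi>\<^sub>M i\<in>I. density lborel std_normal_density)"

definition chi :: "nat \<Rightarrow> real measure" where
  "chi m = density lborel (\<lambda>t. ennreal (chi_density m t))"

lemma unif_sphere_eq: "unif_sphere m = sphere_measure {..<m}"
  unfolding unif_sphere_def sphere_measure_def leb_def unit_ball_set_def dir_def sqnorm_def L2_set_def
  by simp

lemma std_gauss_eq: "std_gauss m = gauss {..<m}"
  by (simp add: std_gauss_def gauss_def)

lemma sets_sphere_measure [simp, measurable_cong]: "sets (sphere_measure I) = sets (Leb I)"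
  by (simp add: sphere_measure_def)

lemma space_sphere_measure [simp]: "space (sphere_measure I) = space (Leb I)"
  by (simp add: sphere_measure_def)

lemma sets_gauss [simp, measurable_cong]: "sets (gauss I) = sets (Leb I)"
  unfolding gauss_def by (intro sets_PiM_cong) auto

lemma space_gauss [simp]: "space (gauss I) = space (Leb I)"
  unfolding gauss_def by (simp add: space_PiM)

lemma sets_chi [simp, measurable_cong]: "sets (chi m) = sets borel"
  by (simp add: chi_def)

lemma space_chi [simp]: "space (chi m) = UNIV"
  by (simp add: chi_def)

lemma coord_measurable:
  "i \<in> I \<Longrightarrow> (\<lambda>x. x i) \<in> borel_measurable (Leb I)"
  using measurable_component_singleton[of i I "\<lambda>_. lborel"] by simp

lemma L2_set_measurable [measurable]: "(\<lambda>x. L2_set x I) \<in> borel_measurable (Leb I)"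
  unfolding L2_set_def
  by (intro measurable_compose[OF _ borel_measurable_sqrt] borel_measurable_sum borel_measurable_power coord_measurable)

lemma measurable_into_Leb:
  assumes "\<And>i. i \<in> I \<Longrightarrow> (\<lambda>x. f x i) \<in> borel_measurable M"
    and "\<And>x. x \<in> space M \<Longrightarrow> f x \<in> extensional I"
  shows "f \<in> measurable M (Leb I)"
  by (rule measurable_PiM_single') (use assms in \<open>auto simp: PiE_def extensional_def\<close>)

lemma dir_measurable [measurable]: "dir I \<in> measurable (Leb I) (Leb I)"
  unfolding dir_def by (rule measurable_into_Leb) (auto intro!: borel_measurable_divide coord_measurable)

lemma scale_measurable [measurable]:
  "(\<lambda>x. \<lambda>i\<in>I. c * x i) \<in> measurable (Leb I) (Leb I)"
  by (rule measurable_into_Leb) (auto intro!: borel_measurable_times coord_measurable)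

lemma L2_set_scale: "0 \<le> c \<Longrightarrow> L2_set (\<lambda>i\<in>I. c * x i) I = c * L2_set x I"
  unfolding L2_set_def
  by (simp add: power_mult_distrib sum_distrib_left[symmetric] real_sqrt_mult)

lemma dir_scale: "0 < c \<Longrightarrow> dir I (\<lambda>i\<in>I. c * x i) = dir I x"
  by (auto simp: dir_def L2_set_scale fun_eq_iff)

text \<open>One-dimensional scaling in each coordinate gives the reweighted image measure the right
  value on boxes, and these values determine a product measure.\<close>

lemma emeasure_Leb_scale:
  assumes I: "finite I" and c: "0 < c" and S: "S \<in> sets (Leb I)"
  shows "emeasure (Leb I) ((\<lambda>x. \<lambda>i\<in>I. c * x i) -` S \<inter> space (Leb I)) * ennreal (c ^ card I)
       = emeasure (Leb I) S"
proof -
  interpret product_sigma_finite "\<lambda>_::nat. lborel :: real measure" ..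
  have sc: "emeasure lborel ((\<lambda>x. c * x) -` A) * ennreal c = emeasure lborel A"
    if "A \<in> sets borel" for A :: "real set"
  proof -
    have "emeasure lborel A = emeasure (density (distr lborel borel ((*) c)) (\<lambda>_. \<bar>c\<bar>)) A"
      using lborel_distr_mult'[of c] c by simp
    also have "\<dots> = ennreal c * emeasure (distr lborel borel ((*) c)) A"
      using that c by (simp add: emeasure_density_const)
    finally show ?thesis using that by (simp add: emeasure_distr mult.commute[of _ "ennreal c"])
  qed
  let ?P = "density (distr (Leb I) (Leb I) (\<lambda>x. \<lambda>i\<in>I. c * x i)) (\<lambda>_. ennreal (c ^ card I))"
  have "?P = Leb I"
  proof (rule PiM_eqI[OF I])
    fix A :: "nat \<Rightarrow> real set" assume A: "\<And>i. i \<in> I \<Longrightarrow> A i \<in> sets lborel"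
    have [measurable]: "Pi\<^sub>E I A \<in> sets (Leb I)"
      by (rule sets_PiM_I_finite) (use I A in auto)
    have "(\<lambda>x. \<lambda>i\<in>I. c * x i) -` Pi\<^sub>E I A \<inter> space (Leb I) = Pi\<^sub>E I (\<lambda>i. (\<lambda>x. c * x) -` A i)"
      by (auto simp: space_PiM PiE_def Pi_def)
    then have "emeasure ?P (Pi\<^sub>E I A)
        = ennreal (c ^ card I) * emeasure (Leb I) (Pi\<^sub>E I (\<lambda>i. (\<lambda>x. c * x) -` A i))"
      by (simp add: emeasure_density_const emeasure_distr)
    also have "\<dots> = (\<Prod>i\<in>I. ennreal c) * (\<Prod>i\<in>I. emeasure lborel ((\<lambda>x. c * x) -` A i))"
    proof (subst emeasure_PiM)
      show "(\<lambda>x. c * x) -` A i \<in> sets lborel" if "i \<in> I" for i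
        using A[OF that] by (simp add: measurable_sets_borel[OF borel_measurable_times])
    qed (use c I in \<open>auto simp: ennreal_power\<close>)
    also have "\<dots> = (\<Prod>i\<in>I. emeasure lborel (A i))"
      unfolding prod.distrib[symmetric] by (intro prod.cong) (use A sc in \<open>auto simp: mult.commute[of "ennreal c"]\<close>)
    finally show "emeasure ?P (Pi\<^sub>E I A) = (\<Prod>i\<in>I. emeasure lborel (A i))" .
  qed simp
  then have "emeasure (Leb I) S = emeasure ?P S" by simp
  also have "\<dots> = ennreal (c ^ card I) * emeasure (Leb I) ((\<lambda>x. \<lambda>i\<in>I. c * x i) -` S \<inter> space (Leb I))"
    using S by (simp add: emeasure_density_const emeasure_distr)
  finally show ?thesis by (simp add: mult.commute)
qed

section \<open>Polar decomposition of Lebesgue measure\<close>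

abbreviation bvol :: "nat set \<Rightarrow> real" where "bvol I \<equiv> unit_ball_vol (real (card I))"

lemma emeasure_L2_ball:
  assumes "finite I" "0 < t"
  shows "emeasure (Leb I) {x \<in> space (Leb I). L2_set x I \<le> t} = ennreal (bvol I * t ^ card I)"
  using emeasure_cball_aux[OF assms] unfolding L2_set_def
  by (simp add: Int_def conj_commute)

lemma prob_space_sphere: 
  assumes "finite I" shows "prob_space (sphere_measure I)"
proof -
  have "emeasure (Leb I) {x \<in> space (Leb I). L2_set x I \<le> 1} = ennreal (bvol I)"
    using emeasure_L2_ball[OF assms, of 1] by simp
  then have "prob_space (uniform_measure (Leb I) {x \<in> space (Leb I). L2_set x I \<le> 1})"
    by (intro prob_space_uniform_measure) (auto simp: ennreal_eq_0_iff not_le)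
  then show ?thesis unfolding sphere_measure_def
    by (rule prob_space.prob_space_distr) simp
qed

text \<open>The part of the cone over \<open>D\<close> within radius \<open>t\<close> is the
  dilation by \<open>t\<close> of its part within radius \<open>1\<close>, as \<open>dir\<close>
  ignores positive factors. At radius \<open>1\<close> the formula is the definition of the cone
  measure.\<close>

lemma emeasure_sphere_cone:
  assumes I: "finite I" and t: "0 < t" and D[measurable]: "D \<in> sets (Leb I)"
  shows "emeasure (Leb I) {x \<in> space (Leb I). L2_set x I \<le> t \<and> dir I x \<in> D}
       = ennreal (bvol I * t ^ card I) * emeasure (sphere_measure I) D"
proof -
  let ?B = "{x \<in> space (Leb I). L2_set x I \<le> 1}"
  let ?C = "{x \<in> space (Leb I). L2_set x I \<le> 1 \<and> dir I x \<in> D}"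
  have vB: "emeasure (Leb I) ?B = ennreal (bvol I)"
    using emeasure_L2_ball[OF I, of 1] by simp
  have "emeasure (sphere_measure I) D
      = emeasure (uniform_measure (Leb I) ?B) (dir I -` D \<inter> space (Leb I))"
    unfolding sphere_measure_def by (subst emeasure_distr) auto
  also have "\<dots> = emeasure (Leb I) (?B \<inter> (dir I -` D \<inter> space (Leb I))) / ennreal (bvol I)"
    using vB by (subst emeasure_uniform_measure) auto
  also have "?B \<inter> (dir I -` D \<inter> space (Leb I)) = ?C" by auto
  finally have "emeasure (sphere_measure I) D * ennreal (bvol I) = emeasure (Leb I) ?C"
    using unit_ball_vol_pos[of "real (card I)"]
    by (simp add: ennreal_divide_times ennreal_times_divide ennreal_mult_divide_eq ennreal_eq_0_iff not_le)
  moreover have "emeasure (Leb I) {x \<in> space (Leb I). L2_set x I \<le> t \<and> dir I x \<in> D}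
      = emeasure (Leb I) ((\<lambda>x. \<lambda>i\<in>I. t * x i) -`
          {x \<in> space (Leb I). L2_set x I \<le> t \<and> dir I x \<in> D} \<inter> space (Leb I)) * ennreal (t ^ card I)"
    by (rule emeasure_Leb_scale[symmetric]) (use I t in auto)
  moreover have "(\<lambda>x. \<lambda>i\<in>I. t * x i) -`
          {x \<in> space (Leb I). L2_set x I \<le> t \<and> dir I x \<in> D} \<inter> space (Leb I) = ?C"
    using t by (auto simp: L2_set_scale dir_scale space_PiM mult_le_cancel_left1)
  ultimately have "emeasure (Leb I) {x \<in> space (Leb I). L2_set x I \<le> t \<and> dir I x \<in> D}
      = emeasure (sphere_measure I) D * ennreal (bvol I) * ennreal (t ^ card I)"
    by simp
  then show ?thesis using t
    by (simp add: ennreal_mult' mult_ac)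
qed

text \<open>Product measures are compared on rectangles. With \<open>D\<close> fixed, both sides are
  measures in \<open>E\<close> on the line, called \<open>?M1\<close> and \<open>?M2\<close>, and
  agreement on half-lines suffices. There the density side integrates the derivative of
  \<open>bvol I * t ^ card I\<close>, and the other side is a cone volume.\<close>

lemma polar_leb:
  assumes I: "finite I" "I \<noteq> {}"
  shows "distr (Leb I) (borel \<Otimes>\<^sub>M Leb I) (\<lambda>x. (L2_set x I, dir I x))
    = density lborel (\<lambda>t. ennreal (indicator {0..} t * (real (card I) * bvol I * t ^ (card I - 1))))
        \<Otimes>\<^sub>M sphere_measure I"
    (is "_ = density lborel ?g \<Otimes>\<^sub>M _")
proof (rule pair_measure_eqI[symmetric])
  interpret S: prob_space "sphere_measure I" by (rule prob_space_sphere[OF I(1)])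
  show "sigma_finite_measure (sphere_measure I)" by unfold_locales
  have [measurable]: "?g \<in> borel_measurable borel" by measurable
  show "sigma_finite_measure (density lborel ?g)"
    by (subst sigma_finite_measure.sigma_finite_iff_density_finite[OF lborel.sigma_finite_measure_axioms]) auto
  show "sets (density lborel ?g \<Otimes>\<^sub>M sphere_measure I)
      = sets (distr (Leb I) (borel \<Otimes>\<^sub>M Leb I) (\<lambda>x. (L2_set x I, dir I x)))"
    by (simp cong: sets_pair_measure_cong)
  fix E D assume E: "E \<in> sets (density lborel ?g)" and "D \<in> sets (sphere_measure I)"
  then have [measurable]: "D \<in> sets (Leb I)" "E \<in> sets borel" by auto
  have N: "card I > 0" using I by (simp add: card_gt_0_iff)
  let ?nu = "emeasure (sphere_measure I) D"
  let ?M1 = "density lborel (\<lambda>t. ?g t * ?nu)"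
  let ?M2 = "distr (density (Leb I) (\<lambda>x. indicator D (dir I x))) borel (\<lambda>x. L2_set x I)"
  have M2: "emeasure ?M2 F = emeasure (Leb I) {x \<in> space (Leb I). L2_set x I \<in> F \<and> dir I x \<in> D}"
    if [measurable]: "F \<in> sets borel" for F
  proof -
    have "emeasure ?M2 F = (\<integral>\<^sup>+x. indicator D (dir I x) *
        indicator ((\<lambda>x. L2_set x I) -` F \<inter> space (Leb I)) x \<partial>Leb I)"
      by (subst emeasure_distr) (auto simp: emeasure_density)
    also have "\<dots> = (\<integral>\<^sup>+x. indicator {x \<in> space (Leb I). L2_set x I \<in> F \<and> dir I x \<in> D} x \<partial>Leb I)"
      by (intro nn_integral_cong) (auto split: split_indicator)
    finally show ?thesis by simp
  qed
  have M1: "emeasure ?M1 F = emeasure (density lborel ?g) F * ?nu"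
    if [measurable]: "F \<in> sets borel" for F
  proof -
    have "emeasure ?M1 F = (\<integral>\<^sup>+t. (?g t * indicator F t) * ?nu \<partial>lborel)"
      by (subst emeasure_density) (auto intro!: nn_integral_cong simp: mult_ac)
    also have "\<dots> = (\<integral>\<^sup>+t. ?g t * indicator F t \<partial>lborel) * ?nu"
      by (rule nn_integral_multc) auto
    finally show ?thesis by (subst emeasure_density) auto
  qed
  have key: "emeasure ?M1 {..t} = emeasure ?M2 {..t}" for t
  proof (cases "t > 0")
    case True
    have "emeasure (density lborel ?g) {..t}
        = (\<integral>\<^sup>+x. ennreal (real (card I) * bvol I * x ^ (card I - 1)) * indicator {0..t} x \<partial>lborel)"
      by (subst emeasure_density) (auto intro!: nn_integral_cong split: split_indicator)
    also have "\<dots> = ennreal (bvol I * t ^ card I - bvol I * 0 ^ card I)"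
      by (rule nn_integral_FTC_Icc) (use True in \<open>auto intro!: derivative_eq_intros\<close>)
    finally have "emeasure (density lborel ?g) {..t} = ennreal (bvol I * t ^ card I)"
      using N by (simp add: zero_power)
    moreover have "emeasure ?M1 {..t} = emeasure (density lborel ?g) {..t} * ?nu"
      by (rule M1) simp
    moreover have "emeasure ?M2 {..t} = emeasure (Leb I) {x \<in> space (Leb I). L2_set x I \<in> {..t} \<and> dir I x \<in> D}"
      by (rule M2) simp
    ultimately show ?thesis using emeasure_sphere_cone[OF I(1) True, of D] by simp
  next
    case False
    have "AE x in lborel. ?g x * ?nu * indicator {..t} x = 0"
      using AE_lborel_singleton[of "0::real"]
      by eventually_elim (use False in \<open>auto split: split_indicator\<close>)
    then have 1: "emeasure ?M1 {..t} = 0"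
      by (subst emeasure_density) (auto simp: nn_integral_0_iff_AE)
    \<comment> \<open>The cone formula needs a positive radius. At \<open>t = 0\<close> the
      half-line still catches the origin, so its mass is bounded by balls of radius \<open>d\<close>
      with \<open>d\<close> tending to \<open>0\<close>.\<close>
    have "emeasure ?M2 {..t} \<le> ennreal (bvol I * d ^ card I)" if d: "d > 0" for d
    proof -
      have "emeasure ?M2 {..t} \<le> emeasure (Leb I) {x \<in> space (Leb I). L2_set x I \<le> d}"
        unfolding M2[of "{..t}", simplified] using False d
        by (intro emeasure_mono) auto
      then show ?thesis by (simp add: emeasure_L2_ball[OF I(1) d])
    qed
    moreover have "((\<lambda>d. ennreal (bvol I * d ^ card I)) \<longlongrightarrow> ennreal (bvol I * 0 ^ card I)) (at_right 0)"
      by (intro tendsto_ennrealI tendsto_intros)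
    ultimately have "emeasure ?M2 {..t} \<le> ennreal (bvol I * 0 ^ card I)"
      by (intro tendsto_lowerbound[where F="at_right (0::real)"])
         (auto simp: eventually_at_right_less intro!: eventually_at_rightI[of 0 1])
    then show ?thesis using 1 N by (simp add: zero_power)
  qed
  have "?M1 = ?M2"
  proof (rule measure_eqI_generator_eq[where \<Omega>=UNIV and E="range (\<lambda>a::real. {..a})"
        and A="\<lambda>n. {..real n}"])
    show "Int_stable (range (\<lambda>a::real. {..a}))"
      by (auto simp: Int_stable_def intro!: image_eqI[where x="min _ _"])
    show "sets ?M1 = sigma_sets UNIV (range (\<lambda>a::real. {..a}))"
      "sets ?M2 = sigma_sets UNIV (range (\<lambda>a::real. {..a}))"
      by (simp_all add: borel_eq_atMost)
    show "(\<Union>i. {..real i}) = UNIV" using real_arch_simple by auto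
    show "emeasure ?M1 {..real n} \<noteq> \<infinity>" for n
    proof -
      \<comment> \<open>Radius \<open>real n + 1\<close>, since \<open>n\<close> may be
        \<open>0\<close> and the ball formula needs a positive radius.\<close>
      have "emeasure ?M2 {..real n} \<le> emeasure (Leb I) {x \<in> space (Leb I). L2_set x I \<le> real n + 1}"
        unfolding M2[of "{..real n}", simplified] by (intro emeasure_mono) auto
      also have "\<dots> < \<infinity>" by (subst emeasure_L2_ball) (use I in auto)
      finally show ?thesis using key by simp
    qed
  qed (use key in auto)
  then have "emeasure (density lborel ?g) E * ?nu
      = emeasure (Leb I) {x \<in> space (Leb I). L2_set x I \<in> E \<and> dir I x \<in> D}"
    using M1[of E] M2[of E] by simp
  also have "\<dots> = emeasure (distr (Leb I) (borel \<Otimes>\<^sub>M Leb I) (\<lambda>x. (L2_set x I, dir I x))) (E \<times> D)"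
    by (subst emeasure_distr) (auto intro!: arg_cong2[where f=emeasure])
  finally show "emeasure (density lborel ?g) E * ?nu
      = emeasure (distr (Leb I) (borel \<Otimes>\<^sub>M Leb I) (\<lambda>x. (L2_set x I, dir I x))) (E \<times> D)" .
qed

section \<open>Radius and direction of a Gaussian vector\<close>

lemma gauss_eq_density:
  assumes I: "finite I"
  shows "gauss I = density (Leb I) 
     (\<lambda>x. ennreal ((1 / sqrt (2 * pi)) ^ card I * exp (- (L2_set x I)\<^sup>2 / 2)))"
    (is "_ = density _ ?G")
proof -
  interpret L: product_sigma_finite "\<lambda>_::nat. lborel :: real measure" ..
  interpret N: prob_space "density lborel std_normal_density"
    by (rule prob_space_normal_density) simp
  interpret product_sigma_finite "\<lambda>_::nat. density lborel std_normal_density" ..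
  have [measurable]: "?G \<in> borel_measurable (Leb I)" by measurable
  have "density (Leb I) ?G = (\<Pi>\<^sub>M i\<in>I. density lborel std_normal_density)"
  proof (rule PiM_eqI[OF I])
    show "sets (density (Leb I) ?G) = sets (\<Pi>\<^sub>M i\<in>I. density lborel std_normal_density)"
      unfolding sets_density by (intro sets_PiM_cong) auto
    fix A :: "nat \<Rightarrow> real set" 
    assume "\<And>i. i \<in> I \<Longrightarrow> A i \<in> sets (density lborel std_normal_density)"
    then have A[measurable]: "\<And>i. i \<in> I \<Longrightarrow> A i \<in> sets borel" by simp
    have B[measurable]: "Pi\<^sub>E I A \<in> sets (Leb I)"
      by (rule sets_PiM_I_finite) (use I A in auto)
    have "emeasure (density (Leb I) ?G) (Pi\<^sub>E I A) = (\<integral>\<^sup>+x. ?G x * indicator (Pi\<^sub>E I A) x \<partial>Leb I)"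
      by (simp add: emeasure_density)
    also have "\<dots> = (\<integral>\<^sup>+x. (\<Prod>i\<in>I. ennreal (std_normal_density (x i)) * indicator (A i) (x i)) \<partial>Leb I)"
    proof (rule nn_integral_cong)
      fix x assume x: "x \<in> space (Leb I)"
      have "(\<Prod>i\<in>I. indicator (A i) (x i)) = (indicator (Pi\<^sub>E I A) x :: ennreal)"
        using x I by (auto simp: indicator_def space_PiM PiE_def Pi_def prod_zero_iff)
      moreover have "(\<Prod>i\<in>I. ennreal (std_normal_density (x i))) = ?G x"
      proof -
        have "(\<Prod>i\<in>I. std_normal_density (x i)) = (1 / sqrt (2 * pi)) ^ card I * exp (- (L2_set x I)\<^sup>2 / 2)"
          by (simp add: std_normal_density_def prod.distrib L2_set_def sum_nonneg prod_dividef
              exp_sum[OF I, symmetric] sum_negf sum_divide_distrib[symmetric] power_divide)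
        then show ?thesis by (simp add: prod_ennreal)
      qed
      ultimately show "?G x * indicator (Pi\<^sub>E I A) x =
          (\<Prod>i\<in>I. ennreal (std_normal_density (x i)) * indicator (A i) (x i))"
        by (simp add: prod.distrib)
    qed
    also have "\<dots> = (\<Prod>i\<in>I. \<integral>\<^sup>+x. ennreal (std_normal_density x) * indicator (A i) x \<partial>lborel)"
      by (rule L.product_nn_integral_prod[OF I]) auto
    also have "\<dots> = (\<Prod>i\<in>I. emeasure (density lborel std_normal_density) (A i))"
      by (intro prod.cong) (auto simp: emeasure_density)
    finally show "emeasure (density (Leb I) ?G) (Pi\<^sub>E I A)
        = (\<Prod>i\<in>I. emeasure (density lborel std_normal_density) (A i))" .
  qed
  then show ?thesis by (simp add: gauss_def)
qed

lemma prob_space_gauss: "prob_space (gauss I)"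
  unfolding gauss_def by (intro prob_space_PiM prob_space_normal_density) simp

lemma chi_density_measurable [measurable]: "chi_density m \<in> borel_measurable borel"
  unfolding chi_density_def by measurable

lemma chi_density_nonneg: "m > 0 \<Longrightarrow> 0 \<le> chi_density m t"
  unfolding chi_density_def by (auto intro!: divide_nonneg_nonneg mult_nonneg_nonneg Gamma_real_nonneg)

text \<open>\<open>m * unit_ball_vol m\<close> is the surface area of the unit sphere, so the left
  side is the area of the sphere of radius \<open>t\<close> times the Gaussian density on it. The
  powers of \<open>pi\<close> cancel, and the functional equation of Gamma absorbs the factor
  \<open>m\<close>.\<close>

lemma chi_density_polar:
  assumes "m > 0" "t \<ge> 0"
  shows "real m * unit_ball_vol (real m) * t ^ (m - 1) * ((1 / sqrt (2 * pi)) ^ m * exp (- t\<^sup>2 / 2))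
    = chi_density m t"
proof -
  have 1: "(1 / sqrt (2 * pi)) ^ m = 1 / (2 powr (real m / 2) * pi powr (real m / 2))"
  proof -
    have "sqrt (2 * pi) ^ m = ((2 * pi) powr (1 / 2)) ^ m" by (simp add: powr_half_sqrt)
    also have "\<dots> = (2 * pi) powr (real m / 2)" by (simp add: powr_power)
    also have "\<dots> = 2 powr (real m / 2) * pi powr (real m / 2)" by (simp add: powr_mult)
    finally show ?thesis by (simp add: power_divide)
  qed
  have 2: "Gamma (real m / 2 + 1) = real m / 2 * Gamma (real m / 2)"
    using assms by (intro Gamma_plus1) auto
  have 3: "Gamma (real m / 2) > 0" using assms by (intro Gamma_real_pos) auto
  have 4: "2 powr (real m / 2 - 1) = 2 powr (real m / 2) / 2" by (simp add: powr_diff)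
  define P T G where "P = pi powr (real m / 2)" and "T = 2 powr (real m / 2)" and "G = Gamma (real m / 2)"
  have pos: "P > 0" "T > 0" "G > 0" using 3 by (auto simp: P_def T_def G_def)
  have "real m * (P / (real m / 2 * G)) * t ^ (m - 1) * (1 / (T * P) * exp (- t\<^sup>2 / 2))
      = t ^ (m - 1) * exp (- t\<^sup>2 / 2) / (T / 2 * G)"
    using pos assms by (simp add: divide_simps)
  then show ?thesis using assms
    unfolding chi_density_def unit_ball_vol_def 1 2 4 P_def T_def G_def by simp
qed

text \<open>The Gaussian density depends on the norm only, so it reweights the radial factor of
  \<open>polar_leb\<close> alone: radius and direction are independent.\<close>

lemma polar_gauss:
  assumes I: "finite I" "I \<noteq> {}"
  shows "distr (gauss I) (borel \<Otimes>\<^sub>M Leb I) (\<lambda>x. (L2_set x I, dir I x))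
    = chi (card I) \<Otimes>\<^sub>M sphere_measure I"
proof -
  let ?T = "\<lambda>x. (L2_set x I, dir I x)"
  let ?G = "\<lambda>t::real. ennreal ((1 / sqrt (2 * pi)) ^ card I * exp (- t\<^sup>2 / 2))"
  let ?g = "\<lambda>t. ennreal (indicator {0..} t * (real (card I) * bvol I * t ^ (card I - 1)))"
  interpret S: prob_space "sphere_measure I" by (rule prob_space_sphere[OF I(1)])
  have N: "card I > 0" using I by (simp add: card_gt_0_iff)
  have [measurable]: "?g \<in> borel_measurable borel" by measurable
  have "distr (gauss I) (borel \<Otimes>\<^sub>M Leb I) ?T = density (distr (Leb I) (borel \<Otimes>\<^sub>M Leb I) ?T) (\<lambda>p. ?G (fst p))"
    unfolding gauss_eq_density[OF I(1)] by (subst density_distr) auto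
  \<comment> \<open>The trivial density \<open>1\<close> on the sphere gives both factors the form
    required by \<open>pair_measure_density\<close>.\<close>
  also have "\<dots> = density (density lborel ?g \<Otimes>\<^sub>M density (sphere_measure I) (\<lambda>_. 1)) (\<lambda>(t, v). ?G t * 1)"
    unfolding polar_leb[OF I] density_1 by (simp add: case_prod_beta' del: indicator_simps)
  also have "\<dots> = density (density lborel ?g) ?G \<Otimes>\<^sub>M density (sphere_measure I) (\<lambda>_. 1)"
    unfolding density_1
  proof (subst pair_measure_density[symmetric])
    show "sigma_finite_measure (sphere_measure I)" "sigma_finite_measure (density (sphere_measure I) (\<lambda>_. 1))"
      unfolding density_1 by unfold_locales
  qed (auto simp: density_1)
  also have "density (density lborel ?g) ?G = chi (card I)"
  proof -
    have "ennreal (indicator {0..} t * (real (card I) * bvol I * t ^ (card I - 1))) * ?G t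
        = ennreal (chi_density (card I) t)" for t
    proof (cases "t \<ge> 0")
      case True
      then show ?thesis unfolding chi_density_polar[OF N True, symmetric]
        by (simp add: ennreal_mult')
    qed (simp add: chi_density_def)
    then show ?thesis unfolding chi_def by (subst density_density_eq) auto
  qed
  finally show ?thesis by (simp add: density_1)
qed

text \<open>The total mass is read off from \<open>polar_gauss\<close>: the Gaussian and the sphere
  measure both have mass \<open>1\<close>, hence so does the chi factor.\<close>

lemma prob_space_chi: "m > 0 \<Longrightarrow> prob_space (chi m)"
proof
  assume m: "m > 0"
  interpret S: prob_space "sphere_measure {..<m}" by (rule prob_space_sphere) simp
  interpret G: prob_space "gauss {..<m}" by (rule prob_space_gauss)
  have "(\<lambda>x. (L2_set x {..<m}, dir {..<m} x)) -` (UNIV \<times> space (sphere_measure {..<m})) \<inter> space (gauss {..<m})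
      = space (gauss {..<m})"
    using measurable_space[OF dir_measurable] by auto
  then have "1 = emeasure (distr (gauss {..<m}) (borel \<Otimes>\<^sub>M Leb {..<m}) (\<lambda>x. (L2_set x {..<m}, dir {..<m} x)))
     (UNIV \<times> space (sphere_measure {..<m}))"
    using G.emeasure_space_1 by (subst emeasure_distr) auto
  also have "\<dots> = emeasure (chi m \<Otimes>\<^sub>M sphere_measure {..<m}) (UNIV \<times> space (sphere_measure {..<m}))"
    using m by (subst polar_gauss) auto
  also have "\<dots> = emeasure (chi m) UNIV * 1"
    by (subst S.emeasure_pair_measure_Times) (use S.emeasure_space_1 in auto)
  finally show "emeasure (chi m) (space (chi m)) = 1" by simp
qed

lemma nn_integral_polar:
  assumes I: "finite I" "I \<noteq> {}" and F[measurable]: "case_prod F \<in> borel_measurable (borel \<Otimes>\<^sub>M Leb I)"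
  shows "(\<integral>\<^sup>+x. F (L2_set x I) (dir I x) \<partial>gauss I) = (\<integral>\<^sup>+v. (\<integral>\<^sup>+t. F t v \<partial>chi (card I)) \<partial>sphere_measure I)"
proof -
  interpret S: prob_space "sphere_measure I" by (rule prob_space_sphere[OF I(1)])
  interpret C: prob_space "chi (card I)" by (rule prob_space_chi) (use I in \<open>simp add: card_gt_0_iff\<close>)
  interpret P: pair_sigma_finite "chi (card I)" "sphere_measure I" ..
  have "(\<integral>\<^sup>+x. F (L2_set x I) (dir I x) \<partial>gauss I) 
      = (\<integral>\<^sup>+p. case_prod F p \<partial>distr (gauss I) (borel \<Otimes>\<^sub>M Leb I) (\<lambda>x. (L2_set x I, dir I x)))"
    by (subst nn_integral_distr) auto
  also have "\<dots> = (\<integral>\<^sup>+v. (\<integral>\<^sup>+t. F t v \<partial>chi (card I)) \<partial>sphere_measure I)"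
    unfolding polar_gauss[OF I] by (subst P.nn_integral_snd[symmetric]) auto
  finally show ?thesis .
qed

section \<open>Moments of the chi distribution\<close>

text \<open>The powers of \<open>t\<close> differ by two, and the normalising constants by the
  factor \<open>m\<close>, through the functional equation of Gamma. All chi moments below, positive
  and negative, come from this relation.\<close>

lemma chi_density_shift:
  assumes "m > 0" shows "t\<^sup>2 * chi_density m t = real m * chi_density (m + 2) t"
proof -
  have 1: "Gamma (real (m + 2) / 2) = real m / 2 * Gamma (real m / 2)"
  proof -
    have "real m / 2 \<notin> \<int>\<^sub>\<le>\<^sub>0" using assms nonpos_Ints_nonpos[of "real m / 2"] by force
    moreover have "real (m + 2) / 2 = real m / 2 + 1" by simp
    ultimately show ?thesis using Gamma_plus1[of "real m / 2"] by metis
  qed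
  have 2: "2 powr (real (m + 2) / 2 - 1) = 2 * 2 powr (real m / 2 - 1)"
    by (simp add: powr_diff add_divide_distrib powr_add)
  have 3: "t ^ (m + 2 - 1) = t\<^sup>2 * t ^ (m - 1)"
    using assms by (cases m) (simp_all add: power2_eq_square)
  have "Gamma (real m / 2) > 0" "2 powr (real m / 2 - 1) > (0::real)" using assms by auto
  then show ?thesis using assms unfolding chi_density_def 1 2 3
    by (simp add: divide_simps)
qed

lemma nn_integral_chi_shift:
  assumes m: "m > 0" and [measurable]: "f \<in> borel_measurable borel"
  shows "(\<integral>\<^sup>+t. ennreal (t\<^sup>2) * f t \<partial>chi m) = ennreal (real m) * (\<integral>\<^sup>+t. f t \<partial>chi (m + 2))"
proof -
  have "(\<integral>\<^sup>+t. ennreal (t\<^sup>2) * f t \<partial>chi m) = (\<integral>\<^sup>+t. ennreal (t\<^sup>2 * chi_density m t) * f t \<partial>lborel)"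
    unfolding chi_def using m
    by (subst nn_integral_density) (auto simp: ennreal_mult chi_density_nonneg mult_ac)
  also have "\<dots> = (\<integral>\<^sup>+t. ennreal (real m) * (ennreal (chi_density (m + 2) t) * f t) \<partial>lborel)"
    unfolding chi_density_shift[OF m] by (simp add: ennreal_mult chi_density_nonneg mult_ac)
  also have "\<dots> = ennreal (real m) * (\<integral>\<^sup>+t. f t \<partial>chi (m + 2))"
    unfolding chi_def by (subst nn_integral_density) (auto simp: nn_integral_cmult)
  finally show ?thesis .
qed

lemma AE_chi_pos: "AE t in chi m. t > 0"
  unfolding chi_def
proof (subst AE_density)
  show "AE t in lborel. 0 < ennreal (chi_density m t) \<longrightarrow> 0 < t"
    using AE_lborel_singleton[of "0::real"] by eventually_elim (auto simp: chi_density_def split: if_splits)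
qed auto

lemma chi_moment2: assumes "m > 0" shows "(\<integral>\<^sup>+t. ennreal (t\<^sup>2) \<partial>chi m) = ennreal (real m)"
proof -
  interpret prob_space "chi (m + 2)" by (rule prob_space_chi) simp
  show ?thesis using nn_integral_chi_shift[OF assms, of "\<lambda>_. 1"] emeasure_space_1 by simp
qed

lemma chi_moment4:
  assumes "m > 0" shows "(\<integral>\<^sup>+t. ennreal (t ^ 4) \<partial>chi m) = ennreal (real m * (real m + 2))"
proof -
  have "ennreal (t\<^sup>2) * ennreal (t\<^sup>2) = ennreal (t ^ 4)" for t :: real
    by (simp add: ennreal_mult[symmetric] flip: power_add)
  then have "(\<integral>\<^sup>+t. ennreal (t ^ 4) \<partial>chi m) = ennreal (real m) * ennreal (real (m + 2))"
    using nn_integral_chi_shift[OF assms, of "\<lambda>t. ennreal (t\<^sup>2)"] chi_moment2[of "m + 2"] by simp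
  then show ?thesis by (simp only: ennreal_mult[symmetric] of_nat_0_le_iff of_nat_add of_nat_numeral)
qed

text \<open>The shift is read backwards, with \<open>1 / t^2\<close> cancelling the factor
  \<open>t^2\<close>; \<open>chi_moment_neg4\<close> repeats this once more.\<close>

lemma chi_moment_neg2:
  assumes "m > 0" shows "(\<integral>\<^sup>+t. ennreal (1 / t\<^sup>2) \<partial>chi (m + 2)) = ennreal (1 / real m)"
proof -
  interpret prob_space "chi m" by (rule prob_space_chi) fact
  have "ennreal (real m) * (\<integral>\<^sup>+t. ennreal (1 / t\<^sup>2) \<partial>chi (m + 2)) = (\<integral>\<^sup>+t. 1 \<partial>chi m)"
    by (subst nn_integral_chi_shift[OF assms, symmetric], simp, rule nn_integral_cong_AE, use AE_chi_pos[of m] in eventually_elim)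
       (simp add: ennreal_mult[symmetric])
  also have "\<dots> = 1" using emeasure_space_1 by simp
  finally have "ennreal (1 / real m) * (ennreal (real m) * (\<integral>\<^sup>+t. ennreal (1 / t\<^sup>2) \<partial>chi (m + 2))) = ennreal (1 / real m)"
    by simp
  then show ?thesis using assms by (simp add: mult.assoc[symmetric] ennreal_mult[symmetric])
qed

lemma chi_moment_neg4:
  assumes "m > 0" 
  shows "(\<integral>\<^sup>+t. ennreal (1 / t ^ 4) \<partial>chi (m + 4)) = ennreal (1 / (real m * (real m + 2)))"
proof -
  have "ennreal (real m + 2) * (\<integral>\<^sup>+t. ennreal (1 / t ^ 4) \<partial>chi (m + 4)) = (\<integral>\<^sup>+t. ennreal (t\<^sup>2) * ennreal (1 / t ^ 4) \<partial>chi (m + 2))"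
    using nn_integral_chi_shift[of "m + 2" "\<lambda>t. ennreal (1 / t ^ 4)"]
    by (simp only: of_nat_add of_nat_numeral add.assoc numeral_plus_numeral add_num_simps) simp
  also have "\<dots> = (\<integral>\<^sup>+t. ennreal (1 / t\<^sup>2) \<partial>chi (m + 2))"
    by (rule nn_integral_cong_AE, use AE_chi_pos[of "m + 2"] in eventually_elim)
       (simp add: ennreal_mult[symmetric] divide_simps flip: power_add)
  also have "\<dots> = ennreal (1 / real m)" by (rule chi_moment_neg2) fact
  finally have "ennreal (1 / (real m + 2)) * (ennreal (real m + 2) * (\<integral>\<^sup>+t. ennreal (1 / t ^ 4) \<partial>chi (m + 4)))
      = ennreal (1 / (real m + 2)) * ennreal (1 / real m)"
    by simp
  then show ?thesis using assms
    by (simp add: mult.assoc[symmetric] ennreal_mult[symmetric] mult.commute[of _ "real m"] del: ennreal_plus)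
qed

lemma chi_variance_sq:
  assumes "m > 0" shows "(\<integral>\<^sup>+t. ennreal ((t\<^sup>2 - real m)\<^sup>2) \<partial>chi m) = ennreal (2 * real m)"
proof -
  interpret prob_space "chi m" by (rule prob_space_chi) fact
  \<comment> \<open>Among extended nonnegative reals the cross term is not subtracted but added on
    the left, and cancelled at the end.\<close>
  have "(\<integral>\<^sup>+t. ennreal ((t\<^sup>2 - real m)\<^sup>2) \<partial>chi m) + ennreal (2 * real m) * (\<integral>\<^sup>+t. ennreal (t\<^sup>2) \<partial>chi m)
     = (\<integral>\<^sup>+t. ennreal ((t\<^sup>2 - real m)\<^sup>2) + ennreal (2 * real m) * ennreal (t\<^sup>2) \<partial>chi m)"
    by (simp add: nn_integral_add nn_integral_cmult)
  also have "\<dots> = (\<integral>\<^sup>+t. ennreal (t ^ 4) + ennreal ((real m)\<^sup>2) \<partial>chi m)"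
  proof (rule nn_integral_cong)
    fix t :: real
    have "(t\<^sup>2 - real m)\<^sup>2 + 2 * real m * t\<^sup>2 = t ^ 4 + (real m)\<^sup>2"
      by (simp add: power2_diff flip: power_mult)
    then show "ennreal ((t\<^sup>2 - real m)\<^sup>2) + ennreal (2 * real m) * ennreal (t\<^sup>2) = ennreal (t ^ 4) + ennreal ((real m)\<^sup>2)"
      by (simp add: ennreal_mult[symmetric] ennreal_plus[symmetric] del: ennreal_plus)
  qed
  also have "\<dots> = ennreal (real m * (real m + 2)) + ennreal ((real m)\<^sup>2)"
    using emeasure_space_1 by (simp add: nn_integral_add chi_moment4[OF assms])
  also have "\<dots> = ennreal (2 * real m) + ennreal (2 * real m * real m)"
    by (simp add: ennreal_plus[symmetric] algebra_simps power2_eq_square del: ennreal_plus)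
  finally show ?thesis
    by (simp add: chi_moment2[OF assms] ennreal_mult[symmetric] ennreal_add_left_cancel add.commute)
qed

section \<open>Logarithmic deviation of a chi radius\<close>

lemma abs_ln_le: assumes "y > (0::real)" shows "\<bar>ln y\<bar> \<le> \<bar>y - 1\<bar> * (1 + 1 / y)"
proof -
  have split: "\<bar>y - 1\<bar> * (1 + 1 / y) = \<bar>y - 1\<bar> + \<bar>y - 1\<bar> / y" by (simp add: distrib_left)
  \<comment> \<open>The inequality \<open>ln z <= z - 1\<close> is used at \<open>y\<close> when
    \<open>y >= 1\<close> and at \<open>1 / y\<close> otherwise; the factor \<open>1 + 1 / y\<close>
    covers both cases.\<close>
  show ?thesis
  proof (cases "y \<ge> 1")
    case True
    then show ?thesis using ln_le_minus_one[OF assms] unfolding split by (simp add: add_increasing2)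
  next
    case False
    have "- ln y \<le> 1 / y - 1" using ln_le_minus_one[of "1 / y"] assms by (simp add: ln_div)
    also have "\<dots> = \<bar>y - 1\<bar> / y" using False assms by (simp add: diff_divide_distrib)
    finally show ?thesis using False assms unfolding split by simp
  qed
qed

lemma weighted_am_gm: assumes "s > (0::real)" shows "a * b \<le> (s * a\<^sup>2 + b\<^sup>2 / s) / 2"
proof -
  have "0 \<le> (s * a - b)\<^sup>2 / s" using assms by simp
  also have "\<dots> = s * a\<^sup>2 + b\<^sup>2 / s - 2 * (a * b)"
    using assms by (simp add: power2_diff field_simps power2_eq_square)
  finally show ?thesis by (simp add: mult.commute)
qed

text \<open>\<open>ln (t / sqrt K)\<close> is half of \<open>ln y\<close> with
  \<open>y = t^2 / K\<close>. The rational bound of \<open>abs_ln_le\<close> leaves only the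
  variance of \<open>t^2\<close> and the inverse fourth moment to be integrated.\<close>

lemma chi_log_deviation:
  assumes K: "K \<ge> 8"
  shows "(\<integral>\<^sup>+t. ennreal \<bar>ln (t / sqrt (real K))\<bar> \<partial>chi K) \<le> ennreal (3 / sqrt (real K))"
proof -
  let ?k = "real K" let ?s = "sqrt (real K)"
  interpret prob_space "chi K" by (rule prob_space_chi) (use K in simp)
  have k: "?k > 0" "?s > 0" "?s\<^sup>2 = ?k" using K by auto
  have pt: "\<bar>ln (t / ?s)\<bar> \<le> (1 / (4 * ?k * ?s)) * (t\<^sup>2 - ?k)\<^sup>2 + (1 / (2 * ?s) + (?k\<^sup>2 / (2 * ?s)) * (1 / t ^ 4))"
    if t: "t > 0" for t :: real
  proof -
    define y where "y = t\<^sup>2 / ?k"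
    have y: "y > 0" using t k by (simp add: y_def)
    have "ln y = 2 * ln (t / ?s)"
      using t k by (simp add: y_def ln_div ln_realpow ln_sqrt)
    then have "2 * \<bar>ln (t / ?s)\<bar> \<le> \<bar>y - 1\<bar> * (1 + 1 / y)"
      using abs_ln_le[OF y] by simp
    \<comment> \<open>The weight \<open>sqrt K\<close> balances the two terms:
      \<open>(y - 1)^2\<close> has mean \<open>2 / K\<close> and \<open>(1 + 1 / y)^2\<close> has
      bounded mean, so both parts are of order \<open>1 / sqrt K\<close>.\<close>
    also have "\<dots> \<le> (?s * \<bar>y - 1\<bar>\<^sup>2 + (1 + 1 / y)\<^sup>2 / ?s) / 2"
      by (rule weighted_am_gm[OF k(2)])
    also have "\<dots> \<le> (?s * \<bar>y - 1\<bar>\<^sup>2 + (2 + 2 * (1 / y)\<^sup>2) / ?s) / 2"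
    proof -
      have "(1 + 1 / y)\<^sup>2 \<le> 2 + 2 * (1 / y)\<^sup>2"
        using zero_le_power2[of "1 - 1 / y"] by (simp add: power2_eq_square algebra_simps)
      then show ?thesis using k by (simp add: divide_right_mono)
    qed
    finally have "\<bar>ln (t / ?s)\<bar> \<le> (?s * \<bar>y - 1\<bar>\<^sup>2 + (2 + 2 * (1 / y)\<^sup>2) / ?s) / 4" by simp
    also have "\<dots> = ?s * (y - 1)\<^sup>2 / 4 + (1 / (2 * ?s) + (1 / y)\<^sup>2 / (2 * ?s))"
      by (simp add: add_divide_distrib)
    also have "(1 / y)\<^sup>2 = ?k\<^sup>2 * (1 / t ^ 4)"
      by (simp add: y_def power_divide flip: power_mult)
    also have "?s * (y - 1)\<^sup>2 / 4 = (1 / (4 * ?k * ?s)) * (t\<^sup>2 - ?k)\<^sup>2"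
    proof -
      have "t\<^sup>2 - ?k = ?k * (y - 1)" using k by (simp add: y_def right_diff_distrib)
      then have "(1 / (4 * ?k * ?s)) * (t\<^sup>2 - ?k)\<^sup>2 = (?k / ?s) * (y - 1)\<^sup>2 / 4"
        using k by (simp add: power2_eq_square mult_ac)
      then show ?thesis by (simp add: real_div_sqrt)
    qed
    finally show ?thesis by (simp add: mult_ac)
  qed
  have "(\<integral>\<^sup>+t. ennreal \<bar>ln (t / ?s)\<bar> \<partial>chi K) \<le> (\<integral>\<^sup>+t. ennreal (1 / (4 * ?k * ?s)) * ennreal ((t\<^sup>2 - ?k)\<^sup>2) +
     (ennreal (1 / (2 * ?s)) + ennreal (?k\<^sup>2 / (2 * ?s)) * ennreal (1 / t ^ 4)) \<partial>chi K)"
  proof (rule nn_integral_mono_AE, use AE_chi_pos[of K] in eventually_elim)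
    case (elim t)
    show ?case using pt[OF elim] k elim
      by (simp add: ennreal_mult[symmetric] ennreal_plus[symmetric] ennreal_leI del: ennreal_plus)
  qed
  also have "\<dots> = ennreal (1 / (4 * ?k * ?s)) * ennreal (2 * ?k) + (ennreal (1 / (2 * ?s)) 
      + ennreal (?k\<^sup>2 / (2 * ?s)) * ennreal (1 / ((?k - 4) * (?k - 2))))"
  proof -
    have "(\<integral>\<^sup>+t. ennreal (1 / t ^ 4) \<partial>chi K) = ennreal (1 / ((?k - 4) * (?k - 2)))"
      using chi_moment_neg4[of "K - 4"] K by (simp add: of_nat_diff)
    moreover have "K > 0" using K by simp
    ultimately show ?thesis
      using emeasure_space_1 by (simp add: nn_integral_add nn_integral_cmult chi_variance_sq)
  qed
  also have "\<dots> = ennreal ((1 / (4 * ?k * ?s)) * (2 * ?k) + (1 / (2 * ?s) + (?k\<^sup>2 / (2 * ?s)) * (1 / ((?k - 4) * (?k - 2)))))"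
    using K by (simp add: ennreal_mult[symmetric] ennreal_plus[symmetric] del: ennreal_plus)
  \<comment> \<open>The three summands are \<open>1\<close>, \<open>1\<close> and at most
    \<open>3\<close> times \<open>1 / (2 * sqrt K)\<close>; the last bound uses
    \<open>K >= 8\<close>, and the total \<open>5 / 2\<close> is rounded up to
    \<open>3\<close>.\<close>
  also have "\<dots> \<le> ennreal (3 / ?s)"
  proof (rule ennreal_leI)
    have "?k\<^sup>2 / ((?k - 4) * (?k - 2)) \<le> 3"
    proof (subst pos_divide_le_eq)
      show "0 < (?k - 4) * (?k - 2)" using K by auto
      have "0 \<le> (?k - 8) * (2 * ?k - 2)" using K by auto
      then show "?k\<^sup>2 \<le> 3 * ((?k - 4) * (?k - 2))"
        by (simp add: algebra_simps power2_eq_square)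
    qed
    then have "(1 + 1 + ?k\<^sup>2 / ((?k - 4) * (?k - 2))) / (2 * ?s) \<le> 5 / (2 * ?s)"
      using k by (intro divide_right_mono) auto
    also have "\<dots> \<le> 3 / ?s" using k by (simp add: field_simps)
    finally show "(1 / (4 * ?k * ?s)) * (2 * ?k) + (1 / (2 * ?s) + (?k\<^sup>2 / (2 * ?s)) * (1 / ((?k - 4) * (?k - 2)))) \<le> 3 / ?s"
      using k by (simp add: add_divide_distrib mult.commute[of _ "2 * ?s"])
  qed
  finally show ?thesis .
qed

section \<open>Chi mass of sets with small logarithmic oscillation\<close>

text \<open>The integrand is \<open>\<psi>'\<close>, and \<open>\<psi> ` J\<close> lies in an interval of length \<open>\<delta>\<close>.\<close>

lemma nn_integral_bounded_oscillation:
  fixes u \<delta> :: real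
  defines "\<psi> \<equiv> \<lambda>s. ln s - ln (s\<^sup>2 + u\<^sup>2) / 2"
  assumes u: "u > 0" and J: "J \<subseteq> {0<..}" "J \<in> sets borel"
    and osc: "\<And>s s'. s \<in> J \<Longrightarrow> s' \<in> J \<Longrightarrow> \<psi> s' - \<psi> s \<le> \<delta>"
  shows "(\<integral>\<^sup>+s. ennreal (u\<^sup>2 / (s * (s\<^sup>2 + u\<^sup>2))) * indicator J s \<partial>lborel) \<le> ennreal \<delta>"
proof (cases "J = {}")
  case False
  then obtain s0 where s0: "s0 \<in> J" by auto
  let ?d = "\<lambda>s. u\<^sup>2 / (s * (s\<^sup>2 + u\<^sup>2))"
  have \<delta>: "\<delta> \<ge> 0" using osc[OF s0 s0] by simp
  define \<alpha> where "\<alpha> = Inf (\<psi> ` J)"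
  have bdd: "bdd_below (\<psi> ` J)"
    by (rule bdd_belowI[of _ "\<psi> s0 - \<delta>"]) (use osc[OF _ s0] in fastforce)
  have lo: "\<alpha> \<le> \<psi> s" if "s \<in> J" for s
    unfolding \<alpha>_def using bdd that by (auto intro: cInf_lower)
  have hi: "\<psi> s \<le> \<alpha> + \<delta>" if "s \<in> J" for s
  proof -
    have "\<psi> s - \<delta> \<le> \<alpha>" unfolding \<alpha>_def
      by (rule cInf_greatest) (use False osc[OF _ that] in fastforce)+
    then show ?thesis by simp
  qed
  have deriv: "(\<psi> has_real_derivative ?d s) (at s)" if "s > 0" for s
  proof -
    have pos: "s\<^sup>2 + u\<^sup>2 > 0" using u by (simp add: add_nonneg_pos)
    have "1 / s - 2 * s / (s\<^sup>2 + u\<^sup>2) / 2 = ?d s"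
    proof -
      define Q where "Q = s\<^sup>2 + u\<^sup>2"
      have Q: "Q > 0" using pos by (simp add: Q_def)
      have "1 / s - s / Q = (Q - s\<^sup>2) / (s * Q)"
        using that Q by (simp add: diff_divide_distrib power2_eq_square)
      moreover have "2 * s / Q / 2 = s / Q" by simp
      ultimately show ?thesis unfolding Q_def[symmetric] by (simp only:) (simp add: Q_def)
    qed
    moreover have "(\<psi> has_real_derivative 1 / s - 2 * s / (s\<^sup>2 + u\<^sup>2) / 2) (at s)"
    proof -
      have "((\<lambda>s. s\<^sup>2 + u\<^sup>2) has_real_derivative 2 * s) (at s)"
        by (auto intro!: derivative_eq_intros)
      from DERIV_ln_divide[OF that] DERIV_cdivide[OF DERIV_chain2[OF DERIV_ln_divide[OF pos] this], of 2]
      show ?thesis unfolding \<psi>_def by (intro DERIV_diff) simp_all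
    qed
    ultimately show ?thesis by simp
  qed
  \<comment> \<open>The substitution rule is applied on compact intervals, so \<open>J\<close> is
    cut off near \<open>0\<close> and near infinity; monotone convergence removes the cut.\<close>
  let ?A = "\<lambda>n::nat. {1 / real (Suc n)..real (Suc n)}"
  have part: "(\<integral>\<^sup>+s. ennreal (?d s) * indicator (J \<inter> ?A n) s \<partial>lborel) \<le> ennreal \<delta>" for n
  proof -
    define a b where "a = 1 / real (Suc n)" and "b = real (Suc n)"
    have ab: "0 < a" "a \<le> b" by (auto simp: a_def b_def field_simps)
    \<comment> \<open>Substituting \<open>x = \<psi> s\<close> bounds the integral by the length of
      an interval that contains all values of \<open>\<psi>\<close> on \<open>J\<close>.\<close>
    let ?f = "indicator {\<alpha>..\<alpha> + \<delta>} :: real \<Rightarrow> real"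
    have "(\<integral>\<^sup>+s. ennreal (?d s) * indicator (J \<inter> ?A n) s \<partial>lborel)
        \<le> (\<integral>\<^sup>+s. ennreal (?f (\<psi> s) * ?d s * indicator {a..b} s) \<partial>lborel)"
      by (intro nn_integral_mono) (auto simp: a_def b_def lo hi split: split_indicator)
    also have "\<dots> = (\<integral>\<^sup>+x. ennreal (?f x * indicator {\<psi> a..\<psi> b} x) \<partial>lborel)"
    proof (rule nn_integral_substitution[symmetric])
      show "set_borel_measurable borel {\<psi> a..\<psi> b} ?f"
        by (auto simp: set_borel_measurable_def)
      show "continuous_on {a..b} ?d" using ab u
        by (intro continuous_intros) (auto simp: add_nonneg_eq_0_iff)
    qed (use ab deriv in auto)
    also have "\<dots> \<le> (\<integral>\<^sup>+x. indicator {\<alpha>..\<alpha> + \<delta>} x \<partial>lborel)"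
      by (intro nn_integral_mono) (auto split: split_indicator)
    also have "\<dots> = ennreal \<delta>" using \<delta> by simp
    finally show ?thesis .
  qed
  have [measurable]: "J \<in> sets borel" by fact
  have sup: "(SUP n. ennreal (?d s) * indicator (J \<inter> ?A n) s) = ennreal (?d s) * indicator J s" for s
  proof (cases "s \<in> J")
    case True
    then have s: "s > 0" using J by auto
    obtain n where n: "max s (1 / s) \<le> real n" using real_arch_simple by blast
    have "1 / s \<le> real (Suc n)" using n by simp
    then have "1 / real (Suc n) \<le> s" using s by (simp add: field_simps)
    then have "s \<in> J \<inter> ?A n" using n True by simp
    then have "ennreal (?d s) * indicator J s \<le> ennreal (?d s) * indicator (J \<inter> ?A n) s"
      using True by simp
    then show ?thesis
      by (intro antisym SUP_least) (auto intro: SUP_upper2 split: split_indicator)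
  qed auto
  have "(\<integral>\<^sup>+s. ennreal (?d s) * indicator J s \<partial>lborel)
      = (\<integral>\<^sup>+s. (SUP n. ennreal (?d s) * indicator (J \<inter> ?A n) s) \<partial>lborel)"
    by (simp only: sup)
  also have "\<dots> = (SUP n. \<integral>\<^sup>+s. ennreal (?d s) * indicator (J \<inter> ?A n) s \<partial>lborel)"
  proof (rule nn_integral_monotone_convergence_SUP)
    have mono: "?A m \<subseteq> ?A n" if "m \<le> n" for m n
    proof
      fix s assume "s \<in> ?A m"
      moreover have "1 / real (Suc n) \<le> 1 / real (Suc m)" using that by (intro frac_le) auto
      ultimately show "s \<in> ?A n" using that by simp
    qed
    show "incseq (\<lambda>n s. ennreal (?d s) * indicator (J \<inter> ?A n) s)"
    proof (intro monoI le_funI)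
      fix m n :: nat and s :: real assume "m \<le> n"
      then have "s \<in> ?A m \<Longrightarrow> s \<in> ?A n" using mono by blast
      then show "ennreal (?d s) * indicator (J \<inter> ?A m) s \<le> ennreal (?d s) * indicator (J \<inter> ?A n) s"
        by (intro mult_left_mono indicator_leI) auto
    qed
  qed auto
  also have "\<dots> \<le> ennreal \<delta>" by (intro SUP_least part)
  finally show ?thesis .
qed simp

text \<open>One term of the exponential series gives \<open>s ^ k <= fact k * exp s\<close>, and
  completing the square bounds \<open>s - s^2 / 2\<close> by \<open>1 / 2\<close>.\<close>

lemma power_times_gauss_le: assumes "s \<ge> 0" shows "s ^ k * exp (- s\<^sup>2 / 2) \<le> fact k * exp (1 / 2 :: real)"
proof -
  have "s ^ k / fact k \<le> exp s"
  proof -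
    have "(\<lambda>n. s ^ n / fact n) sums exp s"
      using exp_converges[of s] by (simp add: divide_inverse mult.commute)
    from sum_le_suminf[OF sums_summable[OF this], of "{k}"] sums_unique[OF this] assms
    show ?thesis by simp
  qed
  then have "s ^ k \<le> fact k * exp s" by (simp add: field_simps)
  then have "s ^ k * exp (- s\<^sup>2 / 2) \<le> fact k * exp s * exp (- s\<^sup>2 / 2)" by (rule mult_right_mono) simp
  also have "\<dots> = fact k * exp (s - s\<^sup>2 / 2)" by (simp add: exp_add[symmetric])
  also have "s - s\<^sup>2 / 2 \<le> 1 / 2" using zero_le_power2[of "s - 1"] by (simp add: power2_diff)
  finally show ?thesis by (simp add: mult_left_mono)
qed

text \<open>A bound for \<open>chi_density r s * s\<close> and
  \<open>chi_density r s * s ^ 3\<close>, uniform in \<open>s > 0\<close>: the numerator is that of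
  \<open>power_times_gauss_le\<close> at the largest exponent \<open>r + 2\<close>, the denominator
  the normalising constant of the chi density.\<close>

definition chi_bound :: "nat \<Rightarrow> real" where
  "chi_bound r = fact (r + 2) * exp (1 / 2) / (2 powr (real r / 2 - 1) * Gamma (real r / 2))"

lemma chi_bound_pos: "r > 0 \<Longrightarrow> chi_bound r > 0"
  by (simp add: chi_bound_def)

text \<open>The last factor is the derivative of \<open>ln (s / sqrt (s^2 + u^2))\<close>, to be
  substituted away. Clearing its denominator leaves \<open>chi_density r s * s ^ 3\<close> and
  \<open>chi_density r s * s * u^2\<close>, and
  \<open>1 + u^2 = (1 + 1 / u^2) * u^2\<close>.\<close>

lemma chi_density_le:
  assumes r: "r > 0" and s: "s > 0" and u: "u > 0"
  shows "chi_density r s \<le> chi_bound r * (1 + 1 / u\<^sup>2) * (u\<^sup>2 / (s * (s\<^sup>2 + u\<^sup>2)))"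
proof -
  define c where "c = 2 powr (real r / 2 - 1) * Gamma (real r / 2)"
  have c: "c > 0" using r by (simp add: c_def)
  have le: "chi_density r s * s ^ Suc k \<le> chi_bound r" if "k \<le> 2" for k
  proof -
    have "s ^ (r - 1) * s ^ Suc k = s ^ (r + k)" using r by (cases r) (simp_all add: power_add)
    then have "chi_density r s * s ^ Suc k = (s ^ (r + k) * exp (- s\<^sup>2 / 2)) / c"
      using s by (simp add: chi_density_def c_def)
    also have "\<dots> \<le> (fact (r + k) * exp (1 / 2)) / c"
      using c s by (intro divide_right_mono power_times_gauss_le) auto
    also have "\<dots> \<le> (fact (r + 2) * exp (1 / 2)) / c"
      using c that by (intro divide_right_mono mult_right_mono fact_mono) auto
    finally show ?thesis by (simp add: chi_bound_def c_def)
  qed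
  have "chi_density r s * (s * (s\<^sup>2 + u\<^sup>2)) = chi_density r s * s ^ Suc 2 + chi_density r s * s ^ Suc 0 * u\<^sup>2"
    by (simp add: distrib_left power2_eq_square power_Suc numeral_2_eq_2 mult_ac)
  also have "\<dots> \<le> chi_bound r + chi_bound r * u\<^sup>2"
    using le[of 2] le[of 0] by (intro add_mono mult_right_mono) auto
  also have "\<dots> = chi_bound r * (1 + 1 / u\<^sup>2) * u\<^sup>2" using u by (simp add: field_simps)
  finally show ?thesis using s u 
    by (simp add: pos_le_divide_eq add_pos_pos)
qed

lemma emeasure_chi_bounded_oscillation:
  fixes u \<delta> :: real
  assumes r: "r > 0" and u: "u > 0" and J: "J \<subseteq> {0<..}" "J \<in> sets borel" and \<delta>: "\<delta> \<ge> 0"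
    and osc: "\<And>s s'. s \<in> J \<Longrightarrow> s' \<in> J \<Longrightarrow>
      (ln s' - ln (s'\<^sup>2 + u\<^sup>2) / 2) - (ln s - ln (s\<^sup>2 + u\<^sup>2) / 2) \<le> \<delta>"
  shows "emeasure (chi r) J \<le> ennreal (chi_bound r * (1 + 1 / u\<^sup>2) * \<delta>)"
proof -
  have [measurable]: "J \<in> sets borel" by fact
  let ?B = "chi_bound r * (1 + 1 / u\<^sup>2)"
  have B: "?B \<ge> 0" using chi_bound_pos[OF r] by simp
  have "emeasure (chi r) J = (\<integral>\<^sup>+s. ennreal (chi_density r s) * indicator J s \<partial>lborel)"
    unfolding chi_def by (simp add: emeasure_density)
  also have "\<dots> \<le> (\<integral>\<^sup>+s. ennreal ?B * (ennreal (u\<^sup>2 / (s * (s\<^sup>2 + u\<^sup>2))) * indicator J s) \<partial>lborel)"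
    using B chi_density_le[OF r _ u] J
    by (intro nn_integral_mono) (auto split: split_indicator simp: ennreal_mult'[symmetric] intro!: ennreal_leI)
  also have "\<dots> = ennreal ?B * (\<integral>\<^sup>+s. ennreal (u\<^sup>2 / (s * (s\<^sup>2 + u\<^sup>2))) * indicator J s \<partial>lborel)"
    by (rule nn_integral_cmult) measurable
  also have "\<dots> \<le> ennreal ?B * ennreal \<delta>"
    by (intro mult_left_mono nn_integral_bounded_oscillation u J osc) auto
  finally show ?thesis using B \<delta> by (simp add: ennreal_mult)
qed

section \<open>Exit bounds for star-shaped sets\<close>

lemma nn_integral_gauss_radial:
  assumes I: "finite I" "I \<noteq> {}" and [measurable]: "f \<in> borel_measurable borel"
  shows "(\<integral>\<^sup>+x. f (L2_set x I) \<partial>gauss I) = (\<integral>\<^sup>+t. f t \<partial>chi (card I))"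
proof -
  interpret S: prob_space "sphere_measure I" by (rule prob_space_sphere[OF I(1)])
  show ?thesis using S.emeasure_space_1 by (subst nn_integral_polar[OF I, of "\<lambda>t v. f t"]) auto
qed

lemma nn_integral_gauss_dir:
  assumes I: "finite I" "I \<noteq> {}" and [measurable]: "f \<in> borel_measurable (Leb I)"
  shows "(\<integral>\<^sup>+x. f (dir I x) \<partial>gauss I) = (\<integral>\<^sup>+v. f v \<partial>sphere_measure I)"
proof -
  interpret C: prob_space "chi (card I)" by (rule prob_space_chi) (use I in \<open>simp add: card_gt_0_iff\<close>)
  show ?thesis using C.emeasure_space_1 by (subst nn_integral_polar[OF I, of "\<lambda>t v. f v"]) auto
qed

lemma nn_integral_gauss_split:
  assumes IJ: "I \<inter> J = {}" "finite I" "finite J" and f: "f \<in> borel_measurable (Leb (I \<union> J))"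
  shows "(\<integral>\<^sup>+x. f x \<partial>gauss (I \<union> J)) = (\<integral>\<^sup>+x. (\<integral>\<^sup>+y. f (merge I J (x, y)) \<partial>gauss J) \<partial>gauss I)"
proof -
  interpret N: prob_space "density lborel std_normal_density"
    by (rule prob_space_normal_density) simp
  interpret product_sigma_finite "\<lambda>_::nat. density lborel std_normal_density" ..
  have "f \<in> borel_measurable (gauss (I \<union> J))"
    using f measurable_cong_sets[OF sets_gauss refl] by blast
  then show ?thesis unfolding gauss_def by (rule product_nn_integral_fold[OF IJ])
qed

lemma L2_set_merge:
  assumes "I \<inter> J = {}" "finite I" "finite J"
  shows "L2_set (merge I J (x, y)) (I \<union> J) = sqrt ((L2_set x I)\<^sup>2 + (L2_set y J)\<^sup>2)"
proof -
  have "(\<Sum>i\<in>I. (merge I J (x, y) i)\<^sup>2) = (\<Sum>i\<in>I. (x i)\<^sup>2)"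
    "(\<Sum>i\<in>J. (merge I J (x, y) i)\<^sup>2) = (\<Sum>i\<in>J. (y i)\<^sup>2)"
    using assms by (auto intro!: sum.cong)
  then show ?thesis using assms by (simp add: L2_set_def sum.union_disjoint sum_nonneg)
qed

lemma scale_dir: 
  assumes "finite I" "i \<in> I" shows "L2_set x I * dir I x i = x i"
proof (cases "L2_set x I = 0")
  case True
  then have "x i = 0" using assms by (simp add: L2_set_eq_0_iff)
  with True show ?thesis by simp
qed (use assms in \<open>simp add: dir_def\<close>)

text \<open>Scaling is combined with projection to the first \<open>r\<close> coordinates, so that a
  set in \<open>r\<close> variables can be tested along rays in \<open>K\<close> dimensions.\<close>

definition scl :: "nat \<Rightarrow> real \<Rightarrow> (nat \<Rightarrow> real) \<Rightarrow> nat \<Rightarrow> real" where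
  "scl r t x = (\<lambda>i\<in>{..<r}. t * x i)"

lemma scl_measurable_pair:
  assumes "r \<le> K" "f \<in> borel_measurable M" "g \<in> measurable M (Leb {..<K})"
  shows "(\<lambda>p. scl r (f p) (g p)) \<in> measurable M (Leb {..<r})"
  unfolding scl_def
proof (rule measurable_into_Leb)
  fix i assume i: "i \<in> {..<r}"
  have "(\<lambda>p. g p i) \<in> borel_measurable M"
    using measurable_compose[OF assms(3) coord_measurable[of i]] i assms(1) by simp
  then show "(\<lambda>p. (\<lambda>i\<in>{..<r}. f p * g p i) i) \<in> borel_measurable M"
    using i assms(2) by simp
qed auto

lemma scl_scl: "scl r s (scl r t x) = scl r (s * t) x"
  by (auto simp: scl_def)

text \<open>Both claims of the theorem become instances: \<open>feas\<close> for \<open>V_K\<close>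
  and \<open>ball_cyl r c\<close> for \<open>W_K\<close>.\<close>

locale star_set =
  fixes r :: nat and S :: "(nat \<Rightarrow> real) set"
  assumes r_pos: "r > 0" and S_sets [measurable]: "S \<in> sets (Leb {..<r})"
    and star: "x \<in> S \<Longrightarrow> 0 < t \<Longrightarrow> t \<le> 1 \<Longrightarrow> scl r t x \<in> S"
begin

lemma star_mono: assumes "scl r b x \<in> S" "0 < a" "a \<le> b" shows "scl r a x \<in> S"
  using star[OF assms(1), of "a / b"] assms(2,3) by (simp add: scl_scl)

text \<open>With \<open>u\<close> the norm of the other coordinates,
  \<open>s / sqrt (s^2 + u^2)\<close> is the norm of the leading block after normalisation. On the
  exit set \<open>?J\<close> the logarithm of this ratio varies by at most
  \<open>ln (b / a)\<close>, so \<open>emeasure_chi_bounded_oscillation\<close> controls its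
  mass.\<close>

lemma radial_exit_bound:
  assumes u: "u > 0" and ab: "0 < a" "a \<le> b" and \<omega>: "\<omega> \<in> space (Leb {..<r})"
  shows "(\<integral>\<^sup>+s. indicator S (scl r (a * s / sqrt (s\<^sup>2 + u\<^sup>2)) \<omega>)
        * (1 - indicator S (scl r (b * s / sqrt (s\<^sup>2 + u\<^sup>2)) \<omega>)) \<partial>chi r)
      \<le> ennreal (chi_bound r * (1 + 1 / u\<^sup>2) * ln (b / a))"
proof -
  let ?w = "\<lambda>s. s / sqrt (s\<^sup>2 + u\<^sup>2)"
  let ?J = "{s \<in> space borel. 0 < s \<and> scl r (a * s / sqrt (s\<^sup>2 + u\<^sup>2)) \<omega> \<in> S 
      \<and> scl r (b * s / sqrt (s\<^sup>2 + u\<^sup>2)) \<omega> \<notin> S}"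
  have [measurable]: "(\<lambda>s. \<omega>) \<in> measurable borel (Leb {..<r})" using \<omega> by simp
  have [measurable]: "(\<lambda>s. scl r (c * s / sqrt (s\<^sup>2 + u\<^sup>2)) \<omega>) \<in> measurable borel (Leb {..<r})" for c :: real
    by (rule scl_measurable_pair[of r r]) auto
  have J: "?J \<in> sets borel" by measurable
  have "(\<integral>\<^sup>+s. indicator S (scl r (a * s / sqrt (s\<^sup>2 + u\<^sup>2)) \<omega>)
        * (1 - indicator S (scl r (b * s / sqrt (s\<^sup>2 + u\<^sup>2)) \<omega>)) \<partial>chi r)
      = (\<integral>\<^sup>+s. indicator ?J s \<partial>chi r)"
    by (rule nn_integral_cong_AE, use AE_chi_pos[of r] in eventually_elim) (simp add: indicator_def)
  also have "\<dots> = emeasure (chi r) ?J" using J by simp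
  also have "\<dots> \<le> ennreal (chi_bound r * (1 + 1 / u\<^sup>2) * ln (b / a))"
  proof (rule emeasure_chi_bounded_oscillation[OF r_pos u _ J])
    fix s s' assume s: "s \<in> ?J" and s': "s' \<in> ?J"
    have pos: "0 < s\<^sup>2 + u\<^sup>2" "0 < s'\<^sup>2 + u\<^sup>2" using u by (simp_all add: add_nonneg_pos)
    \<comment> \<open>Otherwise the exit point at \<open>b * ?w s\<close> would arise by shrinking
      the point of \<open>S\<close> at \<open>a * ?w s'\<close>, and so lie in
      \<open>S\<close>.\<close>
    have "a * ?w s' < b * ?w s"
    proof (rule ccontr)
      assume "\<not> a * ?w s' < b * ?w s"
      then have le: "b * ?w s \<le> a * ?w s'" by (simp only: not_less)
      have "scl r (b * ?w s) \<omega> \<in> S"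
      proof (rule star_mono[OF _ _ le])
        show "scl r (a * ?w s') \<omega> \<in> S" using s' by simp
        show "0 < b * ?w s" using s ab pos by (intro mult_pos_pos divide_pos_pos) auto
      qed
      then show False using s by simp
    qed
    moreover have w: "0 < a * ?w s'" using ab s' pos by (intro mult_pos_pos divide_pos_pos) auto
    ultimately have le: "ln (a * ?w s') \<le> ln (b * ?w s)" by (intro ln_mono) auto
    have "ln (c * ?w t) = ln c + (ln t - ln (t\<^sup>2 + u\<^sup>2) / 2)"
      if "c > 0" "t > 0" "0 < t\<^sup>2 + u\<^sup>2" for c t
    proof -
      have "ln (c * ?w t) = ln c + ln (?w t)" by (rule ln_mult_pos) (use that in \<open>simp_all add: divide_pos_pos\<close>)
      also have "ln (?w t) = ln t - ln (sqrt (t\<^sup>2 + u\<^sup>2))" by (rule ln_divide_pos) (use that in simp_all)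
      finally show ?thesis using that by (simp add: ln_sqrt)
    qed
    then have "ln (a * ?w s') = ln a + (ln s' - ln (s'\<^sup>2 + u\<^sup>2) / 2)"
      "ln (b * ?w s) = ln b + (ln s - ln (s\<^sup>2 + u\<^sup>2) / 2)" using s s' pos ab by auto
    moreover note le
    moreover have "ln (b / a) = ln b - ln a" using ab by (simp add: ln_div)
    ultimately show "(ln s' - ln (s'\<^sup>2 + u\<^sup>2) / 2) - (ln s - ln (s\<^sup>2 + u\<^sup>2) / 2) \<le> ln (b / a)"
      by linarith
  qed (use ab in auto)
  finally show ?thesis .
qed

text \<open>Conditioning on the trailing block \<open>?J\<close> fixes \<open>u\<close>, and polar
  coordinates in the leading block reduce to \<open>radial_exit_bound\<close>. For
  \<open>K >= r + 3\<close> the mean of \<open>1 / u^2\<close> is \<open>1 / (K - r - 2)\<close>, at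
  most \<open>1\<close>, whence the factor \<open>2\<close>.\<close>

lemma sphere_exit_bound:
  assumes K: "K \<ge> r + 3" and ab: "0 < a" "a \<le> b"
  shows "(\<integral>\<^sup>+v. indicator S (scl r a v) * (1 - indicator S (scl r b v)) \<partial>sphere_measure {..<K})
    \<le> ennreal (2 * chi_bound r * ln (b / a))"
proof -
  let ?h = "\<lambda>v. indicator S (scl r a v) * (1 - indicator S (scl r b v)) :: ennreal"
  let ?J = "{r..<K}" and ?R = "{..<r}"
  have un: "{..<K} = ?J \<union> ?R" "?J \<inter> ?R = {}" using K by auto
  have J: "finite ?J" "?J \<noteq> {}" "card ?J = K - r" and R: "finite ?R" "?R \<noteq> {}"
    using K r_pos by auto
  have rK: "r \<le> K" using K by simp
  have [measurable]: "(\<lambda>v. scl r c v) \<in> measurable (Leb {..<K}) (Leb {..<r})" for c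
    by (rule scl_measurable_pair[OF rK]) auto
  have h[measurable]: "?h \<in> borel_measurable (Leb {..<K})" by measurable
  \<comment> \<open>The value infinity at \<open>u <= 0\<close> lets the bound hold for every
    \<open>x\<close>; the chi law of \<open>u\<close> does not charge such values.\<close>
  define G :: "real \<Rightarrow> ennreal" 
    where "G u = (if u > 0 then ennreal (chi_bound r * (1 + 1 / u\<^sup>2) * ln (b / a)) else \<infinity>)" for u
  have [measurable]: "G \<in> borel_measurable borel" unfolding G_def by measurable
  have inner: "(\<integral>\<^sup>+y. ?h (dir {..<K} (merge ?J ?R (x, y))) \<partial>gauss ?R) \<le> G (L2_set x ?J)" for x
  proof (cases "L2_set x ?J > 0")
    case True
    define u where "u = L2_set x ?J"
    have u: "u > 0" using True by (simp add: u_def)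
    \<comment> \<open>Normalising the merged vector divides by \<open>sqrt (s^2 + u^2)\<close>,
      where \<open>s\<close> is the norm of \<open>y\<close>, and \<open>y\<close> itself is
      \<open>s\<close> times its direction.\<close>
    have scl_merge: "scl r c (dir {..<K} (merge ?J ?R (x, y)))
        = scl r (c * L2_set y ?R / sqrt ((L2_set y ?R)\<^sup>2 + u\<^sup>2)) (dir ?R y)" for c y
    proof -
      have "dir {..<K} (merge ?J ?R (x, y)) i = L2_set y ?R * dir ?R y i / sqrt ((L2_set y ?R)\<^sup>2 + u\<^sup>2)" 
        if "i < r" for i
        using that rK un L2_set_merge[of ?J ?R x y] unfolding scale_dir[OF R(1) \<open>i < r\<close>[folded lessThan_iff]]
        by (simp add: dir_def u_def add.commute)
      then show ?thesis by (auto simp: scl_def fun_eq_iff)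
    qed
    let ?F = "\<lambda>s \<omega>. indicator S (scl r (a * s / sqrt (s\<^sup>2 + u\<^sup>2)) \<omega>)
        * (1 - indicator S (scl r (b * s / sqrt (s\<^sup>2 + u\<^sup>2)) \<omega>)) :: ennreal"
    have [measurable]: "(\<lambda>p. scl r (c * fst p / sqrt ((fst p)\<^sup>2 + u\<^sup>2)) (snd p)) 
        \<in> measurable (borel \<Otimes>\<^sub>M Leb ?R) (Leb ?R)" for c :: real
      by (rule scl_measurable_pair[of r r]) auto
    have "(\<integral>\<^sup>+y. ?h (dir {..<K} (merge ?J ?R (x, y))) \<partial>gauss ?R) 
        = (\<integral>\<^sup>+y. ?F (L2_set y ?R) (dir ?R y) \<partial>gauss ?R)"
      by (simp only: scl_merge)
    also have "\<dots> = (\<integral>\<^sup>+\<omega>. (\<integral>\<^sup>+s. ?F s \<omega> \<partial>chi (card ?R)) \<partial>sphere_measure ?R)"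
      by (rule nn_integral_polar[OF R]) (simp add: case_prod_beta')
    also have "\<dots> \<le> (\<integral>\<^sup>+\<omega>. G u \<partial>sphere_measure ?R)"
      by (rule nn_integral_mono) (use radial_exit_bound[OF u ab] u in \<open>simp add: G_def\<close>)
    also have "\<dots> = G u"
      using prob_space.emeasure_space_1[OF prob_space_sphere[OF R(1)]] by simp
    finally show ?thesis by (simp add: u_def)
  qed (simp add: G_def)
  have d: "ln (b / a) \<ge> 0" using ab by simp
  have cb: "chi_bound r > 0" using chi_bound_pos r_pos by simp
  have "(\<integral>\<^sup>+v. ?h v \<partial>sphere_measure {..<K}) = (\<integral>\<^sup>+x. ?h (dir {..<K} x) \<partial>gauss {..<K})"
    by (rule nn_integral_gauss_dir[symmetric]) (use K in \<open>auto simp: lessThan_empty_iff\<close>)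
  also have "\<dots> = (\<integral>\<^sup>+x. (\<integral>\<^sup>+y. ?h (dir {..<K} (merge ?J ?R (x, y))) \<partial>gauss ?R) \<partial>gauss ?J)"
    using nn_integral_gauss_split[OF un(2) J(1) R(1), of "\<lambda>x. ?h (dir {..<K} x)"] 
    unfolding un(1)[symmetric] by simp
  also have "\<dots> \<le> (\<integral>\<^sup>+x. G (L2_set x ?J) \<partial>gauss ?J)"
    by (intro nn_integral_mono inner)
  also have "\<dots> = (\<integral>\<^sup>+u. G u \<partial>chi (K - r))"
    using nn_integral_gauss_radial[OF J(1,2), of G] J(3) by simp
  also have "\<dots> = (\<integral>\<^sup>+u. ennreal (chi_bound r * ln (b / a)) * (1 + ennreal (1 / u\<^sup>2)) \<partial>chi (K - r))"
  proof (rule nn_integral_cong_AE, use AE_chi_pos[of "K - r"] in eventually_elim)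
    case (elim u)
    have "1 + ennreal (1 / u\<^sup>2) = ennreal (1 + 1 / u\<^sup>2)" by simp
    then show ?case using elim d cb by (simp add: G_def ennreal_mult[symmetric] mult_ac del: ennreal_plus)
  qed
  also have "\<dots> = ennreal (chi_bound r * ln (b / a)) * (1 + ennreal (1 / real (K - r - 2)))"
  proof -
    have "K - r - 2 + 2 = K - r" using K by simp
    then have "(\<integral>\<^sup>+u. ennreal (1 / u\<^sup>2) \<partial>chi (K - r)) = ennreal (1 / real (K - r - 2))"
      using chi_moment_neg2[of "K - r - 2"] K by simp
    then show ?thesis
      using prob_space.emeasure_space_1[OF prob_space_chi[of "K - r"]] K
      by (simp add: nn_integral_cmult nn_integral_add del: of_nat_diff)
  qed
  also have "\<dots> \<le> ennreal (chi_bound r * ln (b / a)) * ennreal 2"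
  proof (rule mult_left_mono)
    have "1 + ennreal (1 / real (K - r - 2)) = ennreal (1 + 1 / real (K - r - 2))" by simp
    also have "\<dots> \<le> ennreal 2" using K by (intro ennreal_leI) auto
    finally show "1 + ennreal (1 / real (K - r - 2)) \<le> ennreal 2" .
  qed simp
  also have "\<dots> = ennreal (2 * chi_bound r * ln (b / a))"
    using d cb by (simp add: ennreal_mult[symmetric] mult_ac del: ennreal_numeral)
  finally show ?thesis .
qed

end

section \<open>Hitting probability along a ray and its variance\<close>

context star_set
begin

text \<open>The quantity X(v) of the overview. It equals the radial estimator by
  \<open>chi_cdf_rho\<close>, and for a ball it is almost everywhere the random term in
  \<open>W_K\<close>.\<close>

definition hit :: "nat \<Rightarrow> (nat \<Rightarrow> real) \<Rightarrow> real" where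
  "hit K v = measure (chi K) {t. scl r t v \<in> S}"

context
  fixes K :: nat
  assumes rK: "r \<le> K"
begin

lemma K_facts: "K > 0" "finite {..<K}" "{..<K} \<noteq> {}" "card {..<K} = K"
  using rK r_pos by (auto simp: lessThan_empty_iff)

lemma scl_line_measurable:
  "v \<in> space (Leb {..<K}) \<Longrightarrow> (\<lambda>t. scl r t v) \<in> measurable borel (Leb {..<r})"
  by (rule scl_measurable_pair[OF rK]) auto

lemma hit_sets: "v \<in> space (Leb {..<K}) \<Longrightarrow> {t. scl r t v \<in> S} \<in> sets borel"
  using measurable_sets[OF scl_line_measurable S_sets] by (simp add: vimage_def)

lemma ennreal_hit:
  assumes "v \<in> space (Leb {..<K})"
  shows "ennreal (hit K v) = (\<integral>\<^sup>+t. indicator S (scl r t v) \<partial>chi K)"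
proof -
  interpret C: prob_space "chi K" by (rule prob_space_chi) (rule K_facts)
  have "(\<integral>\<^sup>+t. indicator S (scl r t v) \<partial>chi K) = (\<integral>\<^sup>+t. indicator {t. scl r t v \<in> S} t \<partial>chi K)"
    by (intro nn_integral_cong) (simp add: indicator_def)
  also have "\<dots> = ennreal (hit K v)"
    using hit_sets[OF assms] by (simp add: hit_def C.emeasure_eq_measure)
  finally show ?thesis by simp
qed

lemma hit_bounds: "0 \<le> hit K v" "hit K v \<le> 1"
  using prob_space.prob_le_1[OF prob_space_chi[OF K_facts(1)]] by (auto simp: hit_def)

lemma hit_measurable: "hit K \<in> borel_measurable (Leb {..<K})"
proof -
  interpret C: prob_space "chi K" by (rule prob_space_chi) (rule K_facts)
  note [measurable] = scl_measurable_pair[OF rK]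
  have "(\<lambda>v. \<integral>\<^sup>+t. indicator S (scl r t v) \<partial>chi K) \<in> borel_measurable (Leb {..<K})"
    by (rule C.borel_measurable_nn_integral) measurable
  then have "(\<lambda>v. enn2real (\<integral>\<^sup>+t. indicator S (scl r t v) \<partial>chi K)) \<in> borel_measurable (Leb {..<K})"
    by measurable
  then show ?thesis
    by (rule measurable_cong[THEN iffD1, rotated]) (simp add: ennreal_hit[symmetric] hit_bounds)
qed

text \<open>A chi radius times an independent uniform direction is a Gaussian vector in
  \<open>K\<close> dimensions, and its leading block is Gaussian in \<open>r\<close> dimensions. The
  trailing block integrates to \<open>1\<close>, also when it is empty for
  \<open>r = K\<close>.\<close>

lemma nn_integral_hit: "(\<integral>\<^sup>+v. ennreal (hit K v) \<partial>sphere_measure {..<K}) = emeasure (gauss {..<r}) S"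
proof -
  let ?J = "{r..<K}" and ?R = "{..<r}"
  have un: "{..<K} = ?J \<union> ?R" "?J \<inter> ?R = {}" using rK by auto
  note [measurable] = scl_measurable_pair[OF rK]
  have "(\<integral>\<^sup>+v. ennreal (hit K v) \<partial>sphere_measure {..<K})
      = (\<integral>\<^sup>+v. (\<integral>\<^sup>+t. indicator S (scl r t v) \<partial>chi (card {..<K})) \<partial>sphere_measure {..<K})"
    by (intro nn_integral_cong) (simp add: ennreal_hit)
  also have "\<dots> = (\<integral>\<^sup>+x. indicator S (scl r (L2_set x {..<K}) (dir {..<K} x)) \<partial>gauss {..<K})"
    by (rule nn_integral_polar[symmetric]) (use K_facts in \<open>simp_all add: case_prod_beta'\<close>)
  also have "\<dots> = (\<integral>\<^sup>+x. indicator S (scl r 1 x) \<partial>gauss {..<K})"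
  proof (intro nn_integral_cong)
    fix x
    have "scl r (L2_set x {..<K}) (dir {..<K} x) = scl r 1 x"
      using scale_dir[OF K_facts(2), of _ x] rK by (auto simp: scl_def fun_eq_iff)
    then show "(indicator S (scl r (L2_set x {..<K}) (dir {..<K} x)) :: ennreal) = indicator S (scl r 1 x)"
      by simp
  qed
  also have "\<dots> = (\<integral>\<^sup>+x. (\<integral>\<^sup>+y. indicator S (scl r 1 (merge ?J ?R (x, y))) \<partial>gauss ?R) \<partial>gauss ?J)"
    unfolding un(1) by (rule nn_integral_gauss_split[OF un(2)]) (simp_all add: un(1)[symmetric])
  also have "\<dots> = (\<integral>\<^sup>+x. (\<integral>\<^sup>+y. indicator S y \<partial>gauss ?R) \<partial>gauss ?J)"
  proof (intro nn_integral_cong)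
    fix x y assume "y \<in> space (gauss ?R)"
    then have "scl r 1 (merge ?J ?R (x, y)) = y"
      using un(2) by (auto simp: scl_def fun_eq_iff merge_def space_PiM PiE_def extensional_def)
    then show "(indicator S (scl r 1 (merge ?J ?R (x, y))) :: ennreal) = indicator S y" by simp
  qed
  also have "\<dots> = emeasure (gauss {..<r}) S"
    using prob_space.emeasure_space_1[OF prob_space_gauss[of ?J]] by simp
  finally show ?thesis .
qed

text \<open>The product is at most either factor; the one chosen is the probability that the radius
  \<open>t\<close> and the reference radius \<open>sqrt K\<close> disagree about membership in
  \<open>S\<close>. \<open>sphere_exit_bound\<close> contributes the factor \<open>2\<close> and
  \<open>chi_log_deviation\<close> the factor \<open>3\<close>; \<open>K >= r + 8\<close> meets the
  hypotheses of both.\<close>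

lemma nn_integral_hit_variance:
  assumes K8: "K \<ge> r + 8"
  shows "(\<integral>\<^sup>+v. ennreal (hit K v * (1 - hit K v)) \<partial>sphere_measure {..<K}) \<le> ennreal (6 * chi_bound r / sqrt (real K))"
proof -
  interpret C: prob_space "chi K" by (rule prob_space_chi) (rule K_facts)
  interpret N: prob_space "sphere_measure {..<K}" by (rule prob_space_sphere) simp
  interpret P: pair_sigma_finite "chi K" "sphere_measure {..<K}" ..
  note [measurable] = scl_measurable_pair[OF rK]
  let ?s = "sqrt (real K)"
  let ?D = "\<lambda>a b v. indicator S (scl r a v) * (1 - indicator S (scl r b v)) :: ennreal"
  let ?F = "\<lambda>t v. ?D t ?s v + ?D ?s t v"
  have s: "?s > 0" using K_facts by simp
  have cb: "chi_bound r > 0" using chi_bound_pos r_pos by simp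
  have pt: "ennreal (hit K v * (1 - hit K v)) \<le> (\<integral>\<^sup>+t. ?F t v \<partial>chi K)"
    if v: "v \<in> space (Leb {..<K})" for v
  proof (cases "scl r ?s v \<in> S")
    case True
    have "ennreal (hit K v * (1 - hit K v)) \<le> ennreal (1 - hit K v)"
      using hit_bounds[of v] by (intro ennreal_leI) (simp add: mult_left_le_one_le)
    also have "ennreal (1 - hit K v) = (\<integral>\<^sup>+t. indicator (UNIV - {t. scl r t v \<in> S}) t \<partial>chi K)"
    proof -
      have "1 - hit K v = measure (chi K) (UNIV - {t. scl r t v \<in> S})"
        unfolding hit_def using C.prob_compl[of "{t. scl r t v \<in> S}"] hit_sets[OF v] by simp
      then show ?thesis using hit_sets[OF v] by (simp add: C.emeasure_eq_measure sets.compl_sets)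
    qed
    also have "\<dots> \<le> (\<integral>\<^sup>+t. ?F t v \<partial>chi K)"
      by (intro nn_integral_mono) (use True in \<open>simp add: indicator_def\<close>)
    finally show ?thesis .
  next
    case False
    have "ennreal (hit K v * (1 - hit K v)) \<le> ennreal (hit K v)"
      using hit_bounds[of v] by (intro ennreal_leI) (simp add: mult_left_le)
    also have "\<dots> = (\<integral>\<^sup>+t. indicator S (scl r t v) \<partial>chi K)" by (rule ennreal_hit[OF v])
    also have "\<dots> \<le> (\<integral>\<^sup>+t. ?F t v \<partial>chi K)"
      by (intro nn_integral_mono) (use False in \<open>simp add: indicator_def\<close>)
    finally show ?thesis .
  qed
  \<comment> \<open>Moving inwards never leaves a star-shaped set, so for each \<open>t > 0\<close>
    at most one of the two terms of \<open>?F\<close> is nonzero.\<close>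
  have zero: "?D a b v = 0" if "0 < a" "b \<le> a" "0 < b" for a b v
    using star_mono[of a v b] that by (auto simp: indicator_def)
  have bd: "(\<integral>\<^sup>+v. ?F t v \<partial>sphere_measure {..<K}) \<le> ennreal (2 * chi_bound r) * ennreal \<bar>ln (t / ?s)\<bar>" 
    if t: "t > 0" for t
  proof -
    have *: "(\<integral>\<^sup>+v. ?D a b v \<partial>sphere_measure {..<K}) \<le> ennreal (2 * chi_bound r) * ennreal \<bar>ln (t / ?s)\<bar>"
      if "0 < a" "a \<le> b" "ln (b / a) = \<bar>ln (t / ?s)\<bar>" for a b
      using sphere_exit_bound[of K a b] K8 that cb by (simp add: ennreal_mult)
    show ?thesis
    proof (cases "t \<le> ?s")
      case True
      have "ln (?s / t) = \<bar>ln (t / ?s)\<bar>"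
        using ln_mono[OF True t] t s by (simp add: ln_divide_pos)
      then show ?thesis using *[OF t True] by (simp only: zero[OF s True t] add_0_right)
    next
      case False
      then have le: "?s \<le> t" by simp
      have "ln (t / ?s) = \<bar>ln (t / ?s)\<bar>"
        using ln_mono[OF le s] t s by (simp add: ln_divide_pos)
      then show ?thesis using *[OF s le] by (simp only: zero[OF t le s] add_0_left)
    qed
  qed
  have "(\<integral>\<^sup>+v. ennreal (hit K v * (1 - hit K v)) \<partial>sphere_measure {..<K})
      \<le> (\<integral>\<^sup>+v. (\<integral>\<^sup>+t. ?F t v \<partial>chi K) \<partial>sphere_measure {..<K})"
    by (intro nn_integral_mono pt) simp
  also have "\<dots> = (\<integral>\<^sup>+t. (\<integral>\<^sup>+v. ?F t v \<partial>sphere_measure {..<K}) \<partial>chi K)"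
    by (rule P.Fubini') measurable
  also have "\<dots> \<le> (\<integral>\<^sup>+t. ennreal (2 * chi_bound r) * ennreal \<bar>ln (t / ?s)\<bar> \<partial>chi K)"
    by (rule nn_integral_mono_AE, use AE_chi_pos[of K] in eventually_elim) (rule bd)
  also have "\<dots> = ennreal (2 * chi_bound r) * (\<integral>\<^sup>+t. ennreal \<bar>ln (t / ?s)\<bar> \<partial>chi K)"
    by (rule nn_integral_cmult) measurable
  also have "\<dots> \<le> ennreal (2 * chi_bound r) * ennreal (3 / ?s)"
    using K8 by (intro mult_left_mono chi_log_deviation) auto
  also have "\<dots> = ennreal (6 * chi_bound r / ?s)"
    using cb by (simp add: ennreal_mult[symmetric])
  finally show ?thesis .
qed

lemma integrable_hit: "integrable (sphere_measure {..<K}) (hit K)"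
  "integrable (sphere_measure {..<K}) (\<lambda>v. (hit K v)\<^sup>2)"
proof -
  interpret N: prob_space "sphere_measure {..<K}" by (rule prob_space_sphere) simp
  have [measurable]: "hit K \<in> borel_measurable (sphere_measure {..<K})"
    using hit_measurable measurable_cong_sets[OF sets_sphere_measure refl] by blast
  show "integrable (sphere_measure {..<K}) (hit K)"
    by (rule N.integrable_const_bound[of _ 1]) (auto simp: hit_bounds)
  show "integrable (sphere_measure {..<K}) (\<lambda>v. (hit K v)\<^sup>2)"
    by (rule N.integrable_const_bound[of _ 1]) (auto simp: hit_bounds power_le_one)
qed

lemma expectation_hit: "integral\<^sup>L (sphere_measure {..<K}) (hit K) = measure (gauss {..<r}) S"
proof -
  interpret G: prob_space "gauss {..<r}" by (rule prob_space_gauss)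
  have "ennreal (integral\<^sup>L (sphere_measure {..<K}) (hit K)) = ennreal (measure (gauss {..<r}) S)"
    using nn_integral_eq_integral[OF integrable_hit(1)] nn_integral_hit hit_bounds
    by (simp add: G.emeasure_eq_measure)
  then show ?thesis by (simp add: hit_bounds integral_nonneg_AE)
qed

text \<open>As \<open>hit K\<close> has mean \<open>\<phi>\<close>, expanding the square turns the
  left side into the mean of \<open>hit K v * (1 - hit K v)\<close>.\<close>

lemma variance_gap:
  defines "\<phi> \<equiv> measure (gauss {..<r}) S"
  shows "\<phi> * (1 - \<phi>) - integral\<^sup>L (sphere_measure {..<K}) (\<lambda>v. (hit K v - \<phi>)\<^sup>2)
      \<le> (6 * chi_bound r + real (r + 8)) / sqrt (real K)"
proof (cases "K \<ge> r + 8")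
  case True
  interpret N: prob_space "sphere_measure {..<K}" by (rule prob_space_sphere) simp
  note int[simp] = integrable_hit
  have E: "integral\<^sup>L (sphere_measure {..<K}) (hit K) = \<phi>" by (simp add: expectation_hit \<phi>_def)
  have "(\<lambda>v. (hit K v - \<phi>)\<^sup>2) = (\<lambda>v. (hit K v)\<^sup>2 - 2 * \<phi> * hit K v + \<phi>\<^sup>2)"
    by (simp add: power2_diff fun_eq_iff)
  then have 1: "integral\<^sup>L (sphere_measure {..<K}) (\<lambda>v. (hit K v - \<phi>)\<^sup>2)
      = integral\<^sup>L (sphere_measure {..<K}) (\<lambda>v. (hit K v)\<^sup>2) - 2 * \<phi> * \<phi> + \<phi>\<^sup>2"
    using N.prob_space by (simp add: E)
  have "(\<lambda>v. hit K v * (1 - hit K v)) = (\<lambda>v. hit K v - (hit K v)\<^sup>2)"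
    by (simp add: fun_eq_iff power2_eq_square right_diff_distrib)
  then have 2: "integral\<^sup>L (sphere_measure {..<K}) (\<lambda>v. hit K v * (1 - hit K v))
      = \<phi> - integral\<^sup>L (sphere_measure {..<K}) (\<lambda>v. (hit K v)\<^sup>2)"
    "integrable (sphere_measure {..<K}) (\<lambda>v. hit K v * (1 - hit K v))"
    by (simp_all add: E)
  have cb: "chi_bound r > 0" using chi_bound_pos r_pos by simp
  have "ennreal (integral\<^sup>L (sphere_measure {..<K}) (\<lambda>v. hit K v * (1 - hit K v))) \<le> ennreal (6 * chi_bound r / sqrt (real K))"
    using nn_integral_hit_variance[OF True] nn_integral_eq_integral[OF 2(2)] hit_bounds by simp
  then have "integral\<^sup>L (sphere_measure {..<K}) (\<lambda>v. hit K v * (1 - hit K v)) \<le> 6 * chi_bound r / sqrt (real K)"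
    using cb by (simp add: ennreal_le_iff)
  also have "\<dots> \<le> (6 * chi_bound r + real (r + 8)) / sqrt (real K)"
    by (intro divide_right_mono) auto
  finally show ?thesis using 1 2 by (simp add: power2_eq_square right_diff_distrib)
next
  case False
  \<comment> \<open>Small \<open>K\<close>: the gap is at most \<open>1\<close>, and
    \<open>sqrt K <= K <= r + 8\<close> makes the bound at least \<open>1\<close>. This is the
    origin of the summand \<open>r + 8\<close>.\<close>
  have "real K \<le> (real K)\<^sup>2" using K_facts by (simp add: power2_eq_square)
  then have "sqrt (real K) \<le> real K" using real_sqrt_le_mono[of "real K" "(real K)\<^sup>2"] by simp
  also have "\<dots> \<le> real (r + 8)" using False by simp
  finally have "sqrt (real K) \<le> real (r + 8)" .
  then have "sqrt (real K) \<le> 6 * chi_bound r + real (r + 8)"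
    using chi_bound_pos[OF r_pos] by simp
  then have "1 \<le> (6 * chi_bound r + real (r + 8)) / sqrt (real K)"
    using K_facts by simp
  moreover have "\<phi> * (1 - \<phi>) \<le> 1 * 1"
    unfolding \<phi>_def using prob_space.prob_le_1[OF prob_space_gauss] by (intro mult_mono) auto
  moreover have "integral\<^sup>L (sphere_measure {..<K}) (\<lambda>v. (hit K v - \<phi>)\<^sup>2) \<ge> 0" by simp
  ultimately show ?thesis by linarith
qed

end

end

section \<open>Convex constraints and the radial distance\<close>

text \<open>The gauge integral in \<open>chi_cdf\<close> agrees with the Lebesgue integral because
  the density is integrable, and \<open>{..t}\<close> may replace \<open>{0..t}\<close> because the
  density vanishes below \<open>0\<close>.\<close>

lemma chi_cdf_eq:
  assumes m: "m > 0" and t: "t \<ge> 0" shows "chi_cdf m t = measure (chi m) {..t}"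
proof -
  interpret C: prob_space "chi m" by (rule prob_space_chi) fact
  have int: "integrable lborel (chi_density m)"
  proof (rule integrableI_nonneg)
    have "(\<integral>\<^sup>+x. ennreal (chi_density m x) \<partial>lborel) = emeasure (chi m) UNIV"
      unfolding chi_def by (simp add: emeasure_density)
    then show "(\<integral>\<^sup>+x. ennreal (chi_density m x) \<partial>lborel) < \<infinity>"
      using C.emeasure_space_1 by simp
  qed (auto simp: chi_density_nonneg m)
  then have sint: "set_integrable lborel {0..t} (chi_density m)"
    unfolding set_integrable_def by (intro integrable_mult_indicator) auto
  have nn: "0 \<le> (LINT x : {0..t} | lborel. chi_density m x)"
    unfolding set_lebesgue_integral_def by (intro integral_nonneg_AE) (auto simp: chi_density_nonneg m)
  have "emeasure (chi m) {..t} = (\<integral>\<^sup>+x. ennreal (indicator {0..t} x *\<^sub>R chi_density m x) \<partial>lborel)"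
    unfolding chi_def by (subst emeasure_density)
      (auto intro!: nn_integral_cong split: split_indicator simp: chi_density_def)
  also have "\<dots> = ennreal (LINT x : {0..t} | lborel. chi_density m x)"
    unfolding set_lebesgue_integral_def
    by (rule nn_integral_eq_integral) (use sint in \<open>auto simp: set_integrable_def chi_density_nonneg m\<close>)
  finally have "measure (chi m) {..t} = (LINT x : {0..t} | lborel. chi_density m x)"
    using nn by (simp add: measure_def)
  then show ?thesis using set_borel_integral_eq_integral(2)[OF sint] t by (simp add: chi_cdf_def)
qed

text \<open>Evaluating along one coordinate on the grid \<open>(1/n)\<int>\<close> reduces a separately continuous
  function of \<open>k + 1\<close> variables to countably many functions of \<open>k\<close> variables.\<close>

lemma measurable_separately_continuous:
  fixes f :: "(nat \<Rightarrow> real) \<Rightarrow> real"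
  assumes cont: "\<And>x i. i < r \<Longrightarrow> continuous_on UNIV (\<lambda>t. f (x(i := t)))"
  shows "k \<le> r \<Longrightarrow> (\<lambda>x. f (\<lambda>i. if i < k then x i else a i)) \<in> borel_measurable (Leb {..<r})"
proof (induction k arbitrary: a)
  case (Suc k)
  let ?q = "\<lambda>n x. of_int \<lfloor>real (Suc n) * x k\<rfloor> / real (Suc n) :: real"
  let ?u = "\<lambda>n x. f (\<lambda>i. if i < k then x i else (a(k := ?q n x)) i)"
  have xk: "(\<lambda>x. x k) \<in> borel_measurable (Leb {..<r})"
    by (rule coord_measurable) (use Suc.prems in simp)
  show ?case
  proof (rule borel_measurable_LIMSEQ_real[where u = ?u])
    fix n
    have "(\<lambda>x. \<lfloor>real (Suc n) * x k\<rfloor>) \<in> measurable (Leb {..<r}) (count_space UNIV)"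
      by (rule measurable_compose[OF _ measurable_real_floor]) (intro borel_measurable_times xk, simp)
    then show "?u n \<in> borel_measurable (Leb {..<r})"
      by (rule measurable_compose_countable[where f="\<lambda>j x. f (\<lambda>i. if i < k then x i else (a(k := of_int j / real (Suc n))) i)", rotated])
        (rule Suc.IH, use Suc.prems in simp)
  next
    fix x :: "nat \<Rightarrow> real"
    let ?y = "\<lambda>i. if i < k then x i else a i"
    have "(\<lambda>n. ?q n x) \<longlonglongrightarrow> x k"
    proof (rule real_tendsto_sandwich)
      have "(\<lambda>n. x k - 1 / real (Suc n)) \<longlonglongrightarrow> x k - 0"
        by (intro tendsto_intros LIMSEQ_Suc lim_1_over_n)
      then show "(\<lambda>n. x k - 1 / real (Suc n)) \<longlonglongrightarrow> x k" by simp
      show "\<forall>\<^sub>F n in sequentially. x k - 1 / real (Suc n) \<le> ?q n x"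
      proof (intro always_eventually allI)
        fix n
        have "real (Suc n) * x k - 1 \<le> of_int \<lfloor>real (Suc n) * x k\<rfloor>" by linarith
        then have "(real (Suc n) * x k - 1) / real (Suc n) \<le> ?q n x" by (intro divide_right_mono) auto
        then show "x k - 1 / real (Suc n) \<le> ?q n x" by (simp add: diff_divide_distrib)
      qed
      show "\<forall>\<^sub>F n in sequentially. ?q n x \<le> x k"
      proof (intro always_eventually allI)
        fix n
        have "?q n x \<le> (real (Suc n) * x k) / real (Suc n)" by (intro divide_right_mono of_int_floor_le) auto
        then show "?q n x \<le> x k" by simp
      qed
    qed auto
    moreover have "isCont (\<lambda>t. f (?y(k := t))) (x k)"
      using cont[of k ?y] Suc.prems by (simp add: continuous_on_eq_continuous_at)
    ultimately have lim: "(\<lambda>n. f (?y(k := ?q n x))) \<longlonglongrightarrow> f (?y(k := x k))"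
      by (rule isCont_tendsto_compose[rotated])
    have "?u n x = f (?y(k := ?q n x))" for n
      by (rule arg_cong[where f=f]) (rule ext, simp)
    moreover have "f (\<lambda>i. if i < Suc k then x i else a i) = f (?y(k := x k))"
      by (rule arg_cong[where f=f]) (rule ext, simp add: less_Suc_eq)
    ultimately show "(\<lambda>n. ?u n x) \<longlonglongrightarrow> f (\<lambda>i. if i < Suc k then x i else a i)"
      using lim by (simp only:)
  qed
qed simp

text \<open>\<open>convex_Rn n g\<close> speaks only about functions vanishing from index
  \<open>n\<close> on; the conditions on \<open>zb\<close> and \<open>L\<close> keep all arguments
  of \<open>g\<close> in that class.\<close>

locale convex_constraint =
  fixes r n :: nat and zb :: "nat \<Rightarrow> real" and L :: "nat \<Rightarrow> nat \<Rightarrow> real" and g :: "(nat \<Rightarrow> real) \<Rightarrow> real"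
  assumes r_pos: "r > 0" and zb: "i \<ge> n \<Longrightarrow> zb i = 0" and L: "i \<ge> n \<Longrightarrow> L i j = 0"
    and g: "convex_Rn n g" and neg: "g zb < 0"
begin

definition h :: "(nat \<Rightarrow> real) \<Rightarrow> real" where
  "h z = g (\<lambda>i. zb i + mat_vec r L z i)"

lemma h_convex:
  assumes "0 \<le> \<theta>" "\<theta> \<le> 1"
  shows "h (\<lambda>i. \<theta> * x i + (1 - \<theta>) * y i) \<le> \<theta> * h x + (1 - \<theta>) * h y"
proof -
  have "(\<lambda>i. zb i + mat_vec r L (\<lambda>i. \<theta> * x i + (1 - \<theta>) * y i) i)
      = (\<lambda>i. \<theta> * (zb i + mat_vec r L x i) + (1 - \<theta>) * (zb i + mat_vec r L y i))"
    by (simp add: mat_vec_def fun_eq_iff sum_distrib_left sum.distrib[symmetric] algebra_simps)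
  moreover have "zb i + mat_vec r L z i = 0" if "i \<ge> n" for i z
    using zb L that by (simp add: mat_vec_def)
  ultimately show ?thesis using g assms unfolding h_def convex_Rn_def by simp
qed

lemma h_cong: "(\<And>i. i < r \<Longrightarrow> x i = y i) \<Longrightarrow> h x = h y"
  by (simp add: h_def mat_vec_def)

text \<open>A finite convex function on the real line is continuous. Coordinate lines yield
  measurability of \<open>h\<close>, rays yield closedness in \<open>chi_cdf_rho\<close>.\<close>

lemma h_line_continuous: "continuous_on UNIV (\<lambda>t. h (\<lambda>i. x i + t * d i))"
proof (rule convex_on_continuous)
  show "convex_on UNIV (\<lambda>t. h (\<lambda>i. x i + t * d i))"
  proof (rule convex_onI)
    fix \<theta> s t :: real assume "0 < \<theta>" "\<theta> < 1"
    then have "h (\<lambda>i. (1 - \<theta>) * (x i + s * d i) + (1 - (1 - \<theta>)) * (x i + t * d i))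
        \<le> (1 - \<theta>) * h (\<lambda>i. x i + s * d i) + (1 - (1 - \<theta>)) * h (\<lambda>i. x i + t * d i)"
      by (intro h_convex) auto
    moreover have "(\<lambda>i. (1 - \<theta>) * (x i + s * d i) + (1 - (1 - \<theta>)) * (x i + t * d i))
        = (\<lambda>i. x i + ((1 - \<theta>) *\<^sub>R s + \<theta> *\<^sub>R t) * d i)"
      by (simp add: fun_eq_iff algebra_simps)
    ultimately show "h (\<lambda>i. x i + ((1 - \<theta>) *\<^sub>R s + \<theta> *\<^sub>R t) * d i)
        \<le> (1 - \<theta>) * h (\<lambda>i. x i + s * d i) + \<theta> * h (\<lambda>i. x i + t * d i)" by simp
  qed auto
qed auto

lemma h_measurable: "h \<in> borel_measurable (Leb {..<r})"
proof -
  have "continuous_on UNIV (\<lambda>t. h (x(i := t)))" for x i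
  proof -
    have "(\<lambda>t. h (x(i := t))) = (\<lambda>t. h (\<lambda>j. (x(i := 0)) j + t * (if j = i then 1 else 0)))"
      by (intro ext arg_cong[where f=h]) simp
    moreover have "continuous_on UNIV (\<lambda>t. h (\<lambda>j. (x(i := 0)) j + t * (if j = i then 1 else 0)))"
      by (rule h_line_continuous)
    ultimately show ?thesis by (simp only:)
  qed
  from measurable_separately_continuous[OF this order_refl, of r "\<lambda>_. 0"]
  have "(\<lambda>x. h (\<lambda>i. if i < r then x i else 0)) \<in> borel_measurable (Leb {..<r})" .
  moreover have "(\<lambda>x. h (\<lambda>i. if i < r then x i else 0)) = h" by (intro ext h_cong) simp
  ultimately show ?thesis by (simp only:)
qed

definition feas :: "(nat \<Rightarrow> real) set" where
  "feas = {z \<in> space (Leb {..<r}). h z \<le> 0}"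

lemma h_zero: "h (\<lambda>_. 0) < 0"
  using neg by (simp add: h_def mat_vec_def)

text \<open>The scaled point is a convex combination of \<open>x\<close> and the origin, where
  \<open>h\<close> is negative.\<close>

lemma h_scale_le:
  assumes "h x \<le> 0" "0 \<le> t" "t \<le> 1" shows "h (\<lambda>i. t * x i) \<le> 0"
proof -
  have "h (\<lambda>i. t * x i + (1 - t) * 0) \<le> t * h x + (1 - t) * h (\<lambda>_. 0)"
    using h_convex[OF assms(2,3), of x "\<lambda>_. 0"] by simp
  also have "\<dots> \<le> 0"
    using assms h_zero by (intro add_nonpos_nonpos mult_nonneg_nonpos) auto
  finally show ?thesis by simp
qed

lemma scl_feas: "scl r t v \<in> feas \<longleftrightarrow> h (\<lambda>i. t * v i) \<le> 0"
proof -
  have "h (scl r t v) = h (\<lambda>i. t * v i)" by (rule h_cong) (simp add: scl_def)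
  then show ?thesis by (simp add: feas_def scl_def space_PiM)
qed

sublocale star_set r feas
proof
  show "r > 0" by (rule r_pos)
  show "feas \<in> sets (Leb {..<r})" unfolding feas_def using h_measurable by measurable
  show "scl r t x \<in> feas" if "x \<in> feas" "0 < t" "t \<le> 1" for x t
    unfolding scl_feas using that by (intro h_scale_le) (auto simp: feas_def)
qed

lemma phi_prob_eq: "phi_prob r zb L g = measure (gauss {..<r}) feas"
  by (simp add: phi_prob_def std_gauss_eq feas_def h_def)

lemma rho_eq:
  assumes "r \<le> K"
  shows "rho K zb (pad_mat r L) g v = Sup (ereal ` {t. 0 \<le> t \<and> scl r t v \<in> feas})"
proof -
  have "mat_vec K (pad_mat r L) v i = mat_vec r L v i" for i
    unfolding mat_vec_def pad_mat_def using assms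
    by (intro sum.mono_neutral_cong_right) auto
  moreover have "t * mat_vec r L v i = mat_vec r L (\<lambda>i. t * v i) i" for t i
    by (simp add: mat_vec_def sum_distrib_left mult_ac)
  ultimately show ?thesis
    unfolding rho_def scl_feas h_def by (auto intro!: arg_cong[where f=Sup])
qed

text \<open>The feasible set is closed along rays and star-shaped, so the ray through \<open>v\<close> meets it exactly
  in the scalars \<open>t\<close> with \<open>0 \<le> t \<le> rho v\<close>.\<close>

lemma chi_cdf_rho:
  assumes rK: "r \<le> K" and v: "v \<in> space (Leb {..<K})"
  shows "chi_cdf_ext K (rho K zb (pad_mat r L) g v) = hit K v"
proof -
  let ?T = "{t. 0 \<le> t \<and> scl r t v \<in> feas}"
  have K: "K > 0" using rK r_pos by simp
  have T0: "0 \<in> ?T" unfolding scl_feas using h_zero by simp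
  have down: "s \<in> ?T" if "t \<in> ?T" "0 \<le> s" "s \<le> t" for s t
    using that star_mono[of t v s] T0 by (cases "s = 0") auto
  have closed: "closed ?T"
  proof -
    have "continuous_on UNIV (\<lambda>t. h (\<lambda>i. t * v i))" using h_line_continuous[of "\<lambda>_. 0" v] by simp
    then have "closed ({0..} \<inter> {t. h (\<lambda>i. t * v i) \<le> 0})"
      by (intro closed_Int closed_Collect_le) auto
    then show ?thesis by (simp add: scl_feas Int_def)
  qed
  \<comment> \<open>\<open>hit\<close> also admits negative \<open>t\<close>, which the chi law does
    not charge.\<close>
  have hitT: "hit K v = measure (chi K) ?T"
  proof -
    have "AE t in chi K. t \<in> {t. scl r t v \<in> feas} \<longleftrightarrow> t \<in> ?T"
      using AE_chi_pos[of K] by eventually_elim auto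
    then show ?thesis unfolding hit_def
      by (intro measure_eq_AE) (use hit_sets[OF rK v] closed in auto)
  qed
  show ?thesis
  proof (cases "bdd_above ?T")
    case True
    define c where "c = Sup ?T"
    \<comment> \<open>The supremum is attained because \<open>?T\<close> is closed, so
      \<open>?T\<close> is a full compact interval.\<close>
    have c: "c \<in> ?T" unfolding c_def using T0 True closed by (intro closed_contains_Sup) auto
    have T: "?T = {0..c}"
      using cSup_upper[OF _ True] down[OF c] unfolding c_def by fastforce
    have rho: "rho K zb (pad_mat r L) g v = ereal c"
      unfolding rho_eq[OF rK] T using c by (intro Sup_eqI) auto
    have "measure (chi K) {0..c} = measure (chi K) {..c}"
      by (rule measure_eq_AE, use AE_chi_pos[of K] in eventually_elim) auto
    then show ?thesis unfolding hitT T rho using c K by (simp add: chi_cdf_ext_def chi_cdf_eq)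
  next
    case False
    have T: "?T = {0..}"
    proof (intro equalityI subsetI)
      fix t :: real assume t: "t \<in> {0..}"
      obtain t' where "t' \<in> ?T" "t \<le> t'" using False unfolding bdd_above_def by (meson linear)
      then show "t \<in> ?T" using down t by auto
    qed auto
    \<comment> \<open>If the ray never leaves the feasible set, \<open>rho\<close> is infinite, and
      the value \<open>1\<close> assigned by \<open>chi_cdf_ext\<close> is the full chi
      mass.\<close>
    have rho: "rho K zb (pad_mat r L) g v = \<infinity>"
      unfolding rho_eq[OF rK] T
    proof (rule ereal_top)
      fix B :: real
      have "ereal B \<le> ereal (max B 0)" by simp
      also have "\<dots> \<le> Sup (ereal ` {0..})" by (intro Sup_upper image_eqI[where x="max B 0"]) auto
      finally show "ereal B \<le> Sup (ereal ` {0..})" .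
    qed
    have "measure (chi K) {0..} = measure (chi K) UNIV"
      by (rule measure_eq_AE, use AE_chi_pos[of K] in eventually_elim) auto
    also have "\<dots> = 1" using prob_space.prob_space[OF prob_space_chi[OF K]] by simp
    finally show ?thesis unfolding hitT T rho by (simp add: chi_cdf_ext_def)
  qed
qed

text \<open>The mean subtracted in \<open>V_K\<close> is the Gaussian mass of \<open>feas\<close>:
  the spherical-radial estimator is unbiased by \<open>expectation_hit\<close>.\<close>

lemma V_K_eq:
  assumes "r \<le> K"
  shows "V_K r K zb L g
      = integral\<^sup>L (sphere_measure {..<K}) (\<lambda>v. (hit K v - measure (gauss {..<r}) feas)\<^sup>2)"
proof -
  note eq = chi_cdf_rho[OF assms]
  have "integral\<^sup>L (sphere_measure {..<K}) (\<lambda>v. chi_cdf_ext K (rho K zb (pad_mat r L) g v)) 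
      = measure (gauss {..<r}) feas"
    unfolding expectation_hit[OF assms, symmetric] by (intro Bochner_Integration.integral_cong) (auto simp: eq)
  then show ?thesis unfolding V_K_def unif_sphere_eq Let_def
    by (intro Bochner_Integration.integral_cong) (auto simp: eq)
qed

end

section \<open>Euclidean balls and the gap for \<open>W_K\<close>\<close>

definition ball_cyl :: "nat \<Rightarrow> real \<Rightarrow> (nat \<Rightarrow> real) set" where
  "ball_cyl r c = {z \<in> space (Leb {..<r}). L2_set z {..<r} \<le> c}"

lemma scl_ball_cyl: "0 \<le> t \<Longrightarrow> scl r t v \<in> ball_cyl r c \<longleftrightarrow> t * L2_set v {..<r} \<le> c"
  using L2_set_scale[of t v "{..<r}"] by (simp add: ball_cyl_def scl_def space_PiM)

lemma star_set_ball:
  assumes "r > 0" "c \<ge> 0" shows "star_set r (ball_cyl r c)"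
proof
  show "ball_cyl r c \<in> sets (Leb {..<r})" unfolding ball_cyl_def by measurable
  show "scl r t x \<in> ball_cyl r c" if "x \<in> ball_cyl r c" "0 < t" "t \<le> 1" for x t
  proof -
    have "t * L2_set x {..<r} \<le> 1 * L2_set x {..<r}" using that by (intro mult_right_mono) auto
    then show ?thesis using that by (subst scl_ball_cyl) (auto simp: ball_cyl_def)
  qed
qed fact

lemma gauss_ball_cyl:
  assumes "r > 0" shows "emeasure (gauss {..<r}) (ball_cyl r c) = emeasure (chi r) {..c}"
proof -
  have B: "ball_cyl r c \<in> sets (Leb {..<r})" unfolding ball_cyl_def by measurable
  have "emeasure (gauss {..<r}) (ball_cyl r c) = (\<integral>\<^sup>+x. indicator (ball_cyl r c) x \<partial>gauss {..<r})"
    using B by simp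
  also have "\<dots> = (\<integral>\<^sup>+x. indicator {..c} (L2_set x {..<r}) \<partial>gauss {..<r})"
    by (intro nn_integral_cong) (simp add: ball_cyl_def indicator_def)
  also have "\<dots> = (\<integral>\<^sup>+t. indicator {..c} t \<partial>chi r)"
    using nn_integral_gauss_radial[of "{..<r}" "indicator {..c}"] assms by (simp add: lessThan_empty_iff)
  finally show ?thesis by simp
qed

text \<open>For radius \<open>0\<close>, \<open>hit\<close> is \<open>1\<close> wherever the block vanishes, while its expectation is the
  Gaussian mass of the origin, which is \<open>0\<close>.\<close>

lemma AE_sphere_block_nonzero:
  assumes r: "r > 0" and rK: "r \<le> K"
  shows "AE v in sphere_measure {..<K}. L2_set v {..<r} > 0"
proof -
  interpret star_set r "ball_cyl r 0" by (rule star_set_ball) (use r in auto)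
  have K: "K > 0" using r rK by simp
  have "emeasure (chi r) {..0} = 0"
  proof -
    have "AE t in chi r. t \<notin> {..0}" using AE_chi_pos[of r] by eventually_elim simp
    then have "{..0} \<in> null_sets (chi r)" by (subst AE_iff_null_sets) simp_all
    then show ?thesis by (rule null_setsD1)
  qed
  then have "(\<integral>\<^sup>+v. ennreal (hit K v) \<partial>sphere_measure {..<K}) = 0"
    using nn_integral_hit[OF rK] gauss_ball_cyl[OF r, of 0] by simp
  moreover have "(\<lambda>v. ennreal (hit K v)) \<in> borel_measurable (sphere_measure {..<K})"
    unfolding measurable_cong_sets[OF sets_sphere_measure refl]
    by (rule measurable_compose[OF hit_measurable[OF rK] measurable_ennreal])
  ultimately have "AE v in sphere_measure {..<K}. ennreal (hit K v) = 0"
    by (simp add: nn_integral_0_iff_AE)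
  then show ?thesis
  proof (eventually_elim)
    case (elim v)
    show ?case
    proof (rule ccontr)
      assume "\<not> L2_set v {..<r} > 0"
      then have "L2_set v {..<r} = 0" using L2_set_nonneg[of v "{..<r}"] by linarith
      then have "\<forall>i\<in>{..<r}. v i = 0" by (simp add: L2_set_eq_0_iff)
      then have "scl r t v = scl r 0 v" for t unfolding scl_def by (intro restrict_ext) simp
      then have "scl r t v \<in> ball_cyl r 0" for t by (rule ssubst) (simp add: scl_ball_cyl)
      then have "{t. scl r t v \<in> ball_cyl r 0} = UNIV" by blast
      then have "hit K v = 1" using prob_space.prob_space[OF prob_space_chi[OF K]] by (simp add: hit_def)
      then show False using elim by simp
    qed
  qed
qed

text \<open>For the ball of radius \<open>c\<close>, the ray along \<open>v\<close> leaves at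
  \<open>t = c / L2_set v {..<r}\<close>, so \<open>hit\<close> is the chi distribution function
  there, and the Gaussian mass of the ball is \<open>chi_cdf r c\<close>. Thus \<open>W_K\<close> is
  the variance of \<open>hit\<close>.\<close>

lemma W_gap:
  assumes r: "r > 0" and rK: "r \<le> K" and c: "c > 0"
  shows "W_MC r c - W_K r K c \<le> (6 * chi_bound r + real (r + 8)) / sqrt (real K)"
proof -
  interpret star_set r "ball_cyl r c" by (rule star_set_ball) (use r c in auto)
  have K: "K > 0" using r rK by simp
  interpret C: prob_space "chi K" by (rule prob_space_chi) (rule K)
  have phi: "measure (gauss {..<r}) (ball_cyl r c) = chi_cdf r c"
    using gauss_ball_cyl[OF r, of c] c by (simp add: chi_cdf_eq[OF r] measure_def)
  have cdf: "chi_cdf K (c / sqrt (sqnorm r v)) = measure (chi K) {..c / L2_set v {..<r}}" for v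
    using c by (subst chi_cdf_eq[OF K]) (auto simp: sqnorm_def L2_set_def sum_nonneg)
  have "mono (\<lambda>t. measure (chi K) {..t})"
    by (intro monoI C.finite_measure_mono) auto
  then have "(\<lambda>t. measure (chi K) {..t}) \<in> borel_measurable borel"
    by (rule borel_measurable_mono)
  have Ls: "(\<lambda>v. L2_set v {..<r}) \<in> borel_measurable (sphere_measure {..<K})"
    unfolding L2_set_def measurable_cong_sets[OF sets_sphere_measure refl]
    by (intro measurable_compose[OF _ borel_measurable_sqrt] borel_measurable_sum
        borel_measurable_power coord_measurable) (use rK in auto)
  have [measurable]: "hit K \<in> borel_measurable (sphere_measure {..<K})"
    using hit_measurable[OF rK] measurable_cong_sets[OF sets_sphere_measure refl] by blast
  have hit: "hit K v = measure (chi K) {..c / L2_set v {..<r}}"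
    if L: "L2_set v {..<r} > 0" and v: "v \<in> space (Leb {..<K})" for v
    unfolding hit_def
  proof (rule measure_eq_AE)
    show "AE t in chi K. t \<in> {t. scl r t v \<in> ball_cyl r c} \<longleftrightarrow> t \<in> {..c / L2_set v {..<r}}"
      using AE_chi_pos[of K] by eventually_elim (use L in \<open>simp add: scl_ball_cyl pos_le_divide_eq\<close>)
  qed (use hit_sets[OF rK v] in auto)
  \<comment> \<open>Where the leading block vanishes, \<open>c / 0 = 0\<close> gives the
    distribution function the value \<open>0\<close> while \<open>hit\<close> is \<open>1\<close>;
    the integrands are therefore compared almost everywhere.\<close>
  have "W_K r K c = integral\<^sup>L (sphere_measure {..<K}) (\<lambda>v. (hit K v - chi_cdf r c)\<^sup>2)"
    unfolding W_K_def unif_sphere_eq cdf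
  proof (rule integral_cong_AE)
    have "(\<lambda>v. measure (chi K) {..c / L2_set v {..<r}}) \<in> borel_measurable (sphere_measure {..<K})"
      by (rule measurable_compose[where f="\<lambda>v. c / L2_set v {..<r}" and N=borel
            and g="\<lambda>t. measure (chi K) {..t}"]) (intro borel_measurable_divide borel_measurable_const Ls, fact)
    then show "(\<lambda>v. (measure (chi K) {..c / L2_set v {..<r}} - chi_cdf r c)\<^sup>2) \<in> borel_measurable (sphere_measure {..<K})"
      by measurable
    show "AE v in sphere_measure {..<K}. (measure (chi K) {..c / L2_set v {..<r}} - chi_cdf r c)\<^sup>2
        = (hit K v - chi_cdf r c)\<^sup>2"
      using AE_sphere_block_nonzero[OF r rK] AE_space[of "sphere_measure {..<K}"]
      by eventually_elim (simp add: hit)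
  qed measurable
  then show ?thesis using variance_gap[OF rK] unfolding phi W_MC_def by simp
qed

theorem theorem2p2:
  fixes r :: nat
  assumes "1 \<le> r"
  shows "\<exists>C>0.
    (\<forall>K\<ge>r. \<forall>c>0. W_MC r c - W_K r K c \<le> C / sqrt (real K)) \<and>
    (\<forall>K\<ge>r. \<forall>(n::nat) (zb::nat \<Rightarrow> real) (L::nat \<Rightarrow> nat \<Rightarrow> real) (g::(nat \<Rightarrow> real) \<Rightarrow> real).
        1 \<le> n \<longrightarrow> (\<forall>i\<ge>n. zb i = 0) \<longrightarrow> (\<forall>i j. (n \<le> i \<or> r \<le> j) \<longrightarrow> L i j = 0) \<longrightarrow>
        convex_Rn n g \<longrightarrow> g zb < 0 \<longrightarrow>
        V_MC r zb L g - V_K r K zb L g \<le> C / sqrt (real K))"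
proof (intro exI[of _ "6 * chi_bound r + real (r + 8)"] conjI allI impI)
  \<comment> \<open>The second claim is not deduced from the first: both are instances of
    \<open>variance_gap\<close>, so one constant depending on \<open>r\<close> alone serves for the
    ball and the feasible set.\<close>
  have r: "r > 0" using assms by simp
  show "0 < 6 * chi_bound r + real (r + 8)" using chi_bound_pos[OF r] by simp
  show "W_MC r c - W_K r K c \<le> (6 * chi_bound r + real (r + 8)) / sqrt (real K)"
    if "r \<le> K" "0 < c" for K c
    using W_gap[OF r that] .
  fix K n :: nat and zb :: "nat \<Rightarrow> real" and L :: "nat \<Rightarrow> nat \<Rightarrow> real" and g :: "(nat \<Rightarrow> real) \<Rightarrow> real"
  assume K: "r \<le> K" and "\<forall>i\<ge>n. zb i = 0" "\<forall>i j. n \<le> i \<or> r \<le> j \<longrightarrow> L i j = 0" "convex_Rn n g" "g zb < 0"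
  then interpret convex_constraint r n zb L g
    using r by unfold_locales auto
  show "V_MC r zb L g - V_K r K zb L g \<le> (6 * chi_bound r + real (r + 8)) / sqrt (real K)"
    using variance_gap[OF K] unfolding V_MC_def phi_prob_eq V_K_eq[OF K] .
qed

end
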